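(* Let $f:\mathbb{R}^m\to\mathbb{R}^\ell$ $(m\ge\ell)$ be a strongly convex $C^r$ mapping, where $r$ is an integer satisfying $r\ge2$ or $r=\infty$. Set $$\Sigma=\{\pi\in\mathcal{L}(\mathbb{R}^m,\mathbb{R}^\ell)\mid \text{the problem of minimizing } f+\pi\text{ is not }C^{r-1}\text{ simplicial}\}.$$ If $m-2\ell+4>0$, then for any non-negative real number $s$ satisfying $$s>m\ell-(m-2\ell+4),$$ the set $\Sigma$ has $s$-dimensional Hausdorff measure zero in $\mathcal{L}(\mathbb{R}^m,\mathbb{R}^\ell)$.
   Context: $\mathcal{L}(\mathbb{R}^m,\mathbb{R}^\ell)$ is the space of all linear mappings $\mathbb{R}^m\to\mathbb{R}^\ell$, identified with the Euclidean space $(\mathbb{R}^m)^\ell$ in the obvious way. When $r=\infty$, $C^{r-1}$ means $C^\infty$. Let $L=\{1,\dots,\ell\}$. Strong convexity: for a convex set $X\subset\mathbb{R}^m$, a function $h:X\to\mathbb{R}$ is strongly convex if there exists $\alpha>0$ such that $h(tx+(1-t)y)\le t h(x)+(1-t)h(y)-\frac12\alpha t(1-t)\|x-y\|^2$ for all $x,y\in X$ and $t\in[0,1]$, where $\|\cdot\|$ is the Euclidean norm. A mapping $f=(f_1,\dots,f_\ell):X\to\mathbb{R}^\ell$ is strongly convex if every $f_i$ ($i\in L$) is strongly convex. Pareto sets: for a set $X$ and a mapping $f=(f_1,\dots,f_\ell):X\to\mathbb{R}^\ell$, a point $x\in X$ is a Pareto solution of $f$ if there is no $y\in X$ such that $f_i(y)\le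 f_i(x)$ for all $i\in L$ and $f_j(y)<f_j(x)$ for at least one $j\in L$. The set of Pareto solutions is denoted $X^*(f)$, and the problem of determining $X^*(f)$ is called the problem of minimizing $f$. For a non-empty subset $I=\{i_1,\dots,i_k\}$ of $L$ with $i_1<\dots<i_k$, put $f_I=(f_{i_1},\dots,f_{i_k})$; $X^*(f_I)$ is defined in the same way with $f_I$ in place of $f$. Simplices: $\Delta^{\ell-1}=\{(w_1,\dots,w_\ell)\in\mathbb{R}^\ell\mid\sum_{i=1}^\ell w_i=1,\ w_i\ge0\}$, and for non-empty $I\subset L$, $\Delta_I=\{(w_1,\dots,w_\ell)\in\Delta^{\ell-1}\mid w_i=0\ (i\notin I)\}$; these are regarded as manifolds with corners. $C^p$ mappings and diffeomorphisms: let $p$ be a positive integer or $\infty$. For a $C^p$ manifold $N$ (possibly with corners) and a subset $W$ of a Euclidean space $\mathbb{R}^d$, a mapping $h:N\to W$ is a $C^p$ mapping if $h:N\to\mathbb{R}^d$ is of class $C^p$, and it is a $C^p$ diffeomorphism if $h:N\to\mathbb{R}^d$ is a $C^p$ immersion and $h:N\to W$ is a homeomorphism. $C^0$ mappings and $C^0$ diffeomorphisms are continuous mappings and homeomorphisms, respectively. Simpliciality: let $X\subset\mathbb{R}^m$ and $f:X\to\mathbb{R}^\ell$, and let $p\geq 0$ be an integer or $p=\infty$. The problem of minimizing $f$ is $C^p$ simplicial if there exists a $C^p$ mapping $\Phi:\Delta^{\ell-1}\to X^*(f)$ such that for every non-empty subset $I$ of $L$ both $\Phi|_{\Delta_I}:\Delta_I\to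 X^*(f_I)$ and $f|_{X^*(f_I)}:X^*(f_I)\to f(X^*(f_I))$ are $C^p$ diffeomorphisms. Hausdorff measure: for a real number $s\ge 0$ and $B\subset\mathbb{R}^N$, the $s$-dimensional Hausdorff outer measure of $B$ is the number of points of $B$ if $s=0$, and for $s>0$ it is $\lim_{\delta\to0}\mathcal{H}^s_\delta(B)$, where $\mathcal{H}^s_\delta(B)=\inf\{\sum_{j=1}^\infty(\operatorname{diam}C_j)^s\mid B\subset\bigcup_{j=1}^\infty C_j,\ \operatorname{diam}C_j\le\delta\}$. A set has $s$-dimensional Hausdorff measure zero if this outer measure is $0$. *)

theory Defs
  imports "HOL-Analysis.Analysis" "HOL-Library.Extended_Nat"
begin

section \<open>Mappings of class \<open>C\<^sup>p\<close>, \<open>0 \<le> p \<le> \<infinity>\<close>\<close>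

text \<open>
  \<open>Ck_open k U f\<close> is only meant for open \<open>U\<close>, so that the derivatives at points of \<open>U\<close> do not
  depend on the values of \<open>f\<close> outside \<open>U\<close>. Quantifying over all directions \<open>v\<close> is the same as
  quantifying over the partial derivatives.
\<close>

primrec Ck_open :: "nat \<Rightarrow> 'a::euclidean_space set \<Rightarrow> ('a \<Rightarrow> 'b::euclidean_space) \<Rightarrow> bool" where
  "Ck_open 0 U f \<longleftrightarrow> continuous_on U f"
| "Ck_open (Suc k) U f \<longleftrightarrow>
     (\<forall>x\<in>U. f differentiable (at x)) \<and>
     (\<forall>v. Ck_open k U (\<lambda>x. frechet_derivative f (at x) v))"

definition Cp_open :: "enat \<Rightarrow> 'a::euclidean_space set \<Rightarrow> ('a \<Rightarrow> 'b::euclidean_space) \<Rightarrow> bool" where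
  "Cp_open p U f \<longleftrightarrow> (\<forall>k. enat k \<le> p \<longrightarrow> Ck_open k U f)"

text \<open>
  On a set that need not be open (below: a relatively open subset of a closed orthant), class
  \<open>C\<^sup>p\<close> means that locally there is a \<open>C\<^sup>p\<close> extension to an open set.
\<close>

definition Cp_on :: "enat \<Rightarrow> 'a::euclidean_space set \<Rightarrow> ('a \<Rightarrow> 'b::euclidean_space) \<Rightarrow> bool" where
  "Cp_on p S f \<longleftrightarrow>
     (\<forall>x\<in>S. \<exists>U g. open U \<and> x \<in> U \<and> Cp_open p U g \<and> (\<forall>y\<in>U \<inter> S. g y = f y))"


section \<open>Manifolds with corners in Euclidean space\<close>

text \<open>
  All manifolds with corners that occur are subsets \<open>N\<close> of a Euclidean space \<open>'a\<close>. The model space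
  \<open>[0,\<infinity>)\<^sup>k\<close> (\<open>k \<le> DIM('a)\<close>) is realised inside \<open>'a\<close> itself, as the closed orthant spanned by
  a set \<open>B\<close> of \<open>k\<close> standard basis vectors.
\<close>

definition orthant :: "'a::euclidean_space set \<Rightarrow> 'a set" where
  "orthant B = {y. (\<forall>b\<in>B. 0 \<le> y \<bullet> b) \<and> (\<forall>b\<in>Basis - B. y \<bullet> b = 0)}"

text \<open>
  \<open>corner_chart p N B V \<psi>\<close>: \<open>\<psi>\<close> is (the inverse of) a \<open>C\<^sup>p\<close> chart of \<open>N\<close> defined on the relatively
  open subset \<open>V\<close> of the model orthant, i.e. a \<open>C\<^sup>p\<close> immersion of \<open>V\<close> which is a homeomorphism onto
  a relatively open subset of \<open>N\<close>. The derivative within \<open>V\<close> is uniquely determined on \<open>span B\<close>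
  (the tangent space of the model), and only its values there matter.
\<close>

definition corner_chart ::
    "enat \<Rightarrow> 'a::euclidean_space set \<Rightarrow> 'a set \<Rightarrow> 'a set \<Rightarrow> ('a \<Rightarrow> 'a) \<Rightarrow> bool" where
  "corner_chart p N B V \<psi> \<longleftrightarrow>
     B \<subseteq> Basis \<and>
     openin (top_of_set (orthant B)) V \<and>
     openin (top_of_set N) (\<psi> ` V) \<and>
     (\<exists>\<phi>. homeomorphism V (\<psi> ` V) \<psi> \<phi>) \<and>
     Cp_on p V \<psi> \<and>
     (\<forall>y\<in>V. \<exists>D. (\<psi> has_derivative D) (at y within V) \<and> inj_on D (span B))"

text \<open>
  In the next three definitions \<open>N\<close> is a manifold with corners if \<open>p > 0\<close>: the required charts
  around every point of \<open>N\<close> say in particular that \<open>N\<close> is a \<open>C\<^sup>p\<close> submanifold with corners of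
  \<open>'a\<close>. As transition maps between charts are \<open>C\<^sup>p\<close>, it does not matter which chart is used.
  For \<open>p = 0\<close> the conditions are continuity and being a homeomorphism.
\<close>

definition Cp_map ::
    "enat \<Rightarrow> 'a::euclidean_space set \<Rightarrow> 'b::euclidean_space set \<Rightarrow> ('a \<Rightarrow> 'b) \<Rightarrow> bool" where
  "Cp_map p N W h \<longleftrightarrow>
     h ` N \<subseteq> W \<and>
     (if p = 0 then continuous_on N h
      else \<forall>x\<in>N. \<exists>B V \<psi>. corner_chart p N B V \<psi> \<and> x \<in> \<psi> ` V \<and> Cp_on p V (h \<circ> \<psi>))"

definition Cp_immersion ::
    "enat \<Rightarrow> 'a::euclidean_space set \<Rightarrow> ('a \<Rightarrow> 'b::euclidean_space) \<Rightarrow> bool" where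
  "Cp_immersion p N h \<longleftrightarrow>
     (\<forall>x\<in>N. \<exists>B V \<psi> y D. corner_chart p N B V \<psi> \<and> y \<in> V \<and> \<psi> y = x \<and> Cp_on p V (h \<circ> \<psi>) \<and>
        ((h \<circ> \<psi>) has_derivative D) (at y within V) \<and> inj_on D (span B))"

definition Cp_diffeomorphism ::
    "enat \<Rightarrow> 'a::euclidean_space set \<Rightarrow> 'b::euclidean_space set \<Rightarrow> ('a \<Rightarrow> 'b) \<Rightarrow> bool" where
  "Cp_diffeomorphism p N W h \<longleftrightarrow>
     (p \<noteq> 0 \<longrightarrow> Cp_immersion p N h) \<and> (\<exists>g. homeomorphism N W h g)"


section \<open>Strong convexity\<close>

definition strongly_convex_on :: "'a::euclidean_space set \<Rightarrow> ('a \<Rightarrow> real) \<Rightarrow> bool" where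
  "strongly_convex_on X h \<longleftrightarrow>
     convex X \<and>
     (\<exists>\<alpha>>0. \<forall>x\<in>X. \<forall>y\<in>X. \<forall>t\<in>{0..1}.
        h (t *\<^sub>R x + (1 - t) *\<^sub>R y)
          \<le> t * h x + (1 - t) * h y - 1 / 2 * \<alpha> * t * (1 - t) * (norm (x - y))\<^sup>2)"

definition strongly_convex_mapping ::
    "'a::euclidean_space set \<Rightarrow> ('a \<Rightarrow> real ^ 'l) \<Rightarrow> bool" where
  "strongly_convex_mapping X f \<longleftrightarrow> (\<forall>i. strongly_convex_on X (\<lambda>x. f x $ i))"


section \<open>Pareto sets and simplicial problems\<close>

text \<open>
  The index set \<open>L = {1,\<dots>,\<ell>}\<close> is the finite type \<open>'l\<close>. \<open>pareto_set X f I\<close> is \<open>X\<^sup>*(f\<^sub>I)\<close>;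
  in particular \<open>X\<^sup>*(f)\<close> is \<open>pareto_set X f UNIV\<close>. The order of the components of \<open>f\<^sub>I\<close> is
  irrelevant.
\<close>

definition pareto_set :: "'a set \<Rightarrow> ('a \<Rightarrow> real ^ 'l) \<Rightarrow> 'l set \<Rightarrow> 'a set" where
  "pareto_set X f I =
     {x\<in>X. \<not> (\<exists>y\<in>X. (\<forall>i\<in>I. f y $ i \<le> f x $ i) \<and> (\<exists>j\<in>I. f y $ j < f x $ j))}"

definition simplex_face :: "'l::finite set \<Rightarrow> (real ^ 'l) set" where
  "simplex_face I =
     {w. (\<Sum>i\<in>UNIV. w $ i) = 1 \<and> (\<forall>i. 0 \<le> w $ i) \<and> (\<forall>i. i \<notin> I \<longrightarrow> w $ i = 0)}"

definition simplicial_problem ::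
    "enat \<Rightarrow> 'a::euclidean_space set \<Rightarrow> ('a \<Rightarrow> real ^ 'l) \<Rightarrow> bool" where
  "simplicial_problem p X f \<longleftrightarrow>
     (\<exists>\<Phi> :: real ^ 'l \<Rightarrow> 'a.
        Cp_map p (simplex_face UNIV) (pareto_set X f UNIV) \<Phi> \<and>
        (\<forall>I. I \<noteq> {} \<longrightarrow>
           Cp_diffeomorphism p (simplex_face I) (pareto_set X f I) \<Phi> \<and>
           Cp_diffeomorphism p (pareto_set X f I) (f ` pareto_set X f I) f))"


section \<open>Hausdorff measure\<close>

text \<open>
  Boundedness of the covering sets has to be required explicitly, because \<^const>\<open>diameter\<close> is
  real-valued and has no meaningful value on unbounded sets.
\<close>

definition hausdorff_pre :: "real \<Rightarrow> real \<Rightarrow> 'a::euclidean_space set \<Rightarrow> ennreal" where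
  "hausdorff_pre s \<delta> B =
     (INF C \<in> {C :: nat \<Rightarrow> 'a set. B \<subseteq> (\<Union>j. C j) \<and> (\<forall>j. bounded (C j) \<and> diameter (C j) \<le> \<delta>)}.
        \<Sum>j. ennreal (diameter (C j) powr s))"

definition hausdorff_outer_measure :: "real \<Rightarrow> 'a::euclidean_space set \<Rightarrow> ennreal" where
  "hausdorff_outer_measure s B =
     (if s = 0 then emeasure (count_space UNIV) B
      else Lim (at_right 0) (\<lambda>\<delta>. hausdorff_pre s \<delta> B))"

lemma hausdorff_pre_antimono:
  assumes "d \<le> e"
  shows "hausdorff_pre s e B \<le> hausdorff_pre s d B"
  unfolding hausdorff_pre_def
  by (rule INF_superset_mono) (use assms order_trans in blast)+

text \<open>The limit exists, so the use of \<^const>\<open>Lim\<close> is justified.\<close>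

lemma hausdorff_pre_tendsto:
  "((\<lambda>\<delta>. hausdorff_pre s \<delta> B) \<longlongrightarrow> (SUP \<delta>\<in>{0<..}. hausdorff_pre s \<delta> B)) (at_right 0)"
proof (rule increasing_tendsto)
  show "\<forall>\<^sub>F d in at_right 0. hausdorff_pre s d B \<le> (SUP \<delta>\<in>{0<..}. hausdorff_pre s \<delta> B)"
    by (auto simp: eventually_at_filter intro!: always_eventually SUP_upper)
next
  fix x assume "x < (SUP \<delta>\<in>{0<..}. hausdorff_pre s \<delta> B)"
  then obtain e where e: "e > 0" "x < hausdorff_pre s e B"
    by (auto simp: less_SUP_iff)
  have "x < hausdorff_pre s d B" if "d < e" for d
    using e(2) hausdorff_pre_antimono[of d e s B] that by (meson less_le_trans less_imp_le)
  then show "\<forall>\<^sub>F d in at_right 0. x < hausdorff_pre s d B"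
    using e(1) by (auto simp: eventually_at_right_field)
qed

lemma hausdorff_outer_measure_eq_SUP:
  "s \<noteq> 0 \<Longrightarrow> hausdorff_outer_measure s B = (SUP \<delta>\<in>{0<..}. hausdorff_pre s \<delta> B)"
  unfolding hausdorff_outer_measure_def
  by (simp add: tendsto_Lim[OF trivial_limit_at_right_real hausdorff_pre_tendsto])

end

theory Submission
  imports Defs
begin

text \<open>
  Let \<open>g\<close> be strongly convex of class \<open>C\<^sup>r\<close>. For weights \<open>w\<close> in the simplex, the scalarisation
  \<open>w \<bullet> g\<close> has a unique minimiser \<open>\<Phi> w\<close>, the unique zero of its gradient. As the Hessian is
  positive definite, the implicit function theorem makes \<open>\<Phi>\<close> of class \<open>C\<^sup>r\<^sup>-\<^sup>1\<close> near the simplex, and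
  separation of convex sets shows that \<open>\<Phi>\<close> maps each face onto the corresponding Pareto set.
  Differentiating \<open>\<Sum>i. w\<^sub>i \<nabla>g\<^sub>i (\<Phi> w) = 0\<close> shows that \<open>\<Phi>\<close> and \<open>g \<circ> \<Phi>\<close> are injective immersions as soon
  as the rows of the Jacobian matrix of \<open>g\<close> never satisfy two independent linear relations at a
  Pareto point. So if \<open>f + \<pi>\<close> is not simplicial, then \<open>\<pi> + df\<^sub>x\<close> has rank at most \<open>\<ell> - 2\<close> for some
  \<open>x\<close>. Matrices of such a rank depend on \<open>m \<ell> - 2 (m - \<ell> + 2)\<close> parameters, hence the bad \<open>\<pi>\<close> lie in
  a finite union of \<open>C\<^sup>1\<close> images of a space of dimension \<open>m + m \<ell> - 2 (m - \<ell> + 2) = m \<ell> - (m - 2 \<ell> + 4)\<close>.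
\<close>

section \<open>Calculus of maps of class \<open>C\<^sup>k\<close>\<close>

text \<open>Everything is reduced to one pointwise condition: where some simplex weight
  \<open>w\<close> has \<open>wgrad g w x = 0\<close>, no nonzero zero-sum \<open>u\<close> has
  \<open>wgrad g u x = 0\<close>. As \<open>w\<close> has coordinate sum 1 and \<open>u\<close> has
  sum 0, a violation always yields two independent relations, hence the corank 2 behind the constant
  \<open>m - 2 l + 4\<close>. Two obstacles shape the rest. The simplex is not open, and weights
  just outside it may be negative, where no minimiser need exist; smoothness of
  \<open>\<Phi>\<close> is therefore expressed by local extensions, which the implicit function
  theorem supplies. And the matrices of low rank do not form a submanifold; they are covered by
  finitely many polynomial images of coordinate subspaces, one for each pair of rows that the
  remaining rows express. The base point \<open>x\<close> adds \<open>m\<close> parameters and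
  enters through the Jacobian matrix of \<open>f\<close>, which for \<open>r = 2\<close> is merely
  of class \<open>C^1\<close>. That is enough: \<open>C^1\<close> maps are Lipschitz on bounded
  boxes, so they send a \<open>d\<close>-dimensional box to a null set for every exponent above
  \<open>d\<close>.\<close>

lemma Ck_open_cong:
  assumes "open U" "\<And>x. x \<in> U \<Longrightarrow> f x = g x"
  shows "Ck_open k U f = Ck_open k U g"
  using assms(2)
proof (induction k arbitrary: f g)
  case 0
  then show ?case by (simp cong: continuous_on_cong)
next
  case (Suc k)
  have der: "(f has_derivative D) (at x) \<longleftrightarrow> (g has_derivative D) (at x)" if "x \<in> U" for x D
    using has_derivative_transform_within_open[OF _ \<open>open U\<close> that] Suc.prems by metis
  \<comment> \<open>\<open>frechet_derivative\<close> is a choice among all derivatives, so equality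
    of the two derivative relations already makes the chosen values equal.\<close>
  then have "frechet_derivative f (at x) = frechet_derivative g (at x)" if "x \<in> U" for x
    using that by (simp add: frechet_derivative_def)
  then have "Ck_open k U (\<lambda>x. frechet_derivative f (at x) v)
      = Ck_open k U (\<lambda>x. frechet_derivative g (at x) v)" for v
    by (intro Suc.IH) auto
  then show ?case
    using der by (auto simp: differentiable_def)
qed

text \<open>The form in which the recursion is used: each closure property below exhibits an
  explicit derivative, and the induction hypothesis is applied to that formula.\<close>

lemma Ck_openI:
  assumes "open U" "\<And>x. x \<in> U \<Longrightarrow> (f has_derivative D x) (at x)"
    and "\<And>v. Ck_open k U (\<lambda>x. D x v)"
  shows "Ck_open (Suc k) U f"
proof -
  have "frechet_derivative f (at x) = D x" if "x \<in> U" for x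
    using frechet_derivative_at[OF assms(2)[OF that]] by simp
  then have "Ck_open k U (\<lambda>x. frechet_derivative f (at x) v) = Ck_open k U (\<lambda>x. D x v)" for v
    by (intro Ck_open_cong \<open>open U\<close>) simp
  with assms show ?thesis
    by (auto simp: differentiable_def)
qed

lemma Ck_open_derivative:
  assumes "Ck_open (Suc k) U f" "x \<in> U"
  shows "(f has_derivative frechet_derivative f (at x)) (at x)"
  using assms frechet_derivative_works by auto

lemma Ck_open_subset: "Ck_open k U f \<Longrightarrow> V \<subseteq> U \<Longrightarrow> Ck_open k V f"
  by (induction k arbitrary: f) (auto intro: continuous_on_subset)

lemma differentiable_imp_continuous_on_set:
  "(\<And>x. x \<in> U \<Longrightarrow> f differentiable (at x)) \<Longrightarrow> continuous_on U f"
  by (simp add: continuous_at_imp_continuous_on differentiable_imp_continuous_within)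

lemma Ck_open_imp_continuous_on: "Ck_open k U f \<Longrightarrow> continuous_on U f"
  by (cases k) (auto intro: differentiable_imp_continuous_on_set)

lemma Ck_open_Suc_imp: "Ck_open (Suc k) U f \<Longrightarrow> Ck_open k U f"
proof (induction k arbitrary: f)
  case 0
  then show ?case using Ck_open_imp_continuous_on[OF 0] by simp
next
  case (Suc k)
  then show ?case by (metis Ck_open.simps(2))
qed

lemma Ck_open_const: "open U \<Longrightarrow> Ck_open k U (\<lambda>x. c)"
proof (induction k arbitrary: c)
  case (Suc k)
  then show ?case by (intro Ck_openI[where D="\<lambda>_ _. 0"]) auto
qed auto

lemma Ck_open_bounded_linear:
  assumes "open U" "bounded_linear L"
  shows "Ck_open k U L"
proof (cases k)
  case 0
  then show ?thesis by (simp add: assms(2) linear_continuous_on)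
next
  case (Suc n)
  show ?thesis unfolding Suc
    by (intro Ck_openI[where D="\<lambda>_. L"])
      (auto intro: assms Ck_open_const bounded_linear_imp_has_derivative)
qed

lemma Ck_open_compose_bounded_linear:
  assumes "open U" "bounded_linear L"
  shows "Ck_open k U f \<Longrightarrow> Ck_open k U (\<lambda>x. L (f x))"
proof (induction k arbitrary: f)
  case 0
  then show ?case using bounded_linear.continuous_on[OF assms(2)] by auto
next
  case (Suc k)
  show ?case
    using Suc.prems Suc.IH
    by (intro Ck_openI[where D="\<lambda>x v. L (frechet_derivative f (at x) v)"] assms
        bounded_linear.has_derivative[OF assms(2)] Ck_open_derivative[OF Suc.prems]) auto
qed

lemma Ck_open_add:
  assumes "open U"
  shows "Ck_open k U f \<Longrightarrow> Ck_open k U g \<Longrightarrow> Ck_open k U (\<lambda>x. f x + g x)"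
proof (induction k arbitrary: f g)
  case 0
  then show ?case by (auto intro: continuous_intros)
next
  case (Suc k)
  show ?case
    using Suc.prems Suc.IH
    by (intro Ck_openI[where D="\<lambda>x v. frechet_derivative f (at x) v + frechet_derivative g (at x) v"]
        assms has_derivative_add Ck_open_derivative[OF Suc.prems(1)]
        Ck_open_derivative[OF Suc.prems(2)]) auto
qed

lemma Ck_open_sum:
  assumes "open U" "\<And>i. i \<in> I \<Longrightarrow> Ck_open k U (f i)"
  shows "Ck_open k U (\<lambda>x. \<Sum>i\<in>I. f i x)"
  using assms(2)
  by (induction I rule: infinite_finite_induct)
    (auto intro: Ck_open_const Ck_open_add assms(1))

lemma Ck_open_bilinear:
  assumes "open U" "bounded_bilinear p"
  shows "Ck_open k U f \<Longrightarrow> Ck_open k U g \<Longrightarrow> Ck_open k U (\<lambda>x. p (f x) (g x))"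
proof (induction k arbitrary: f g)
  case 0
  then show ?case using bounded_bilinear.continuous_on[OF assms(2)] by auto
next
  case (Suc k)
  show ?case
    using Suc.prems Suc.prems[THEN Ck_open_Suc_imp] Suc.IH
    by (intro Ck_openI[where D="\<lambda>x v. p (f x) (frechet_derivative g (at x) v)
          + p (frechet_derivative f (at x) v) (g x)"]
        assms bounded_bilinear.FDERIV[OF assms(2)] Ck_open_add
        Ck_open_derivative[OF Suc.prems(1)] Ck_open_derivative[OF Suc.prems(2)]) auto
qed

lemmas Ck_open_mult = Ck_open_bilinear[OF _ bounded_bilinear_mult]
lemmas Ck_open_scaleR = Ck_open_bilinear[OF _ bounded_bilinear_scaleR]

lemma Ck_open_prod:
  fixes f :: "'i \<Rightarrow> 'a::euclidean_space \<Rightarrow> real"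
  assumes "open U" "\<And>i. i \<in> I \<Longrightarrow> Ck_open k U (f i)"
  shows "Ck_open k U (\<lambda>x. \<Prod>i\<in>I. f i x)"
  using assms(2)
  by (induction I rule: infinite_finite_induct)
    (auto intro: Ck_open_const Ck_open_mult assms(1))

lemma linear_eq_sum_Basis:
  assumes "linear D"
  shows "D v = (\<Sum>b\<in>Basis. (v \<bullet> b) *\<^sub>R D (b::'a::euclidean_space))"
proof -
  have "D v = D (\<Sum>b\<in>Basis. (v \<bullet> b) *\<^sub>R b)" by (simp add: euclidean_representation)
  also have "\<dots> = (\<Sum>b\<in>Basis. (v \<bullet> b) *\<^sub>R D b)"
    by (simp add: linear_sum[OF assms] linear_scale[OF assms])
  finally show ?thesis .
qed

text \<open>In the chain rule the direction fed to the derivative of \<open>f\<close> varies with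
  \<open>x\<close>, whereas \<open>Ck_open\<close> controls that derivative in fixed directions.
  Expanding in \<open>Basis\<close> separates the two, and the induction hypothesis applies to each
  partial derivative of \<open>f\<close> composed with \<open>g\<close>.\<close>

lemma Ck_open_compose:
  assumes "open U" "open V" "\<And>x. x \<in> U \<Longrightarrow> g x \<in> V"
  shows "Ck_open k V f \<Longrightarrow> Ck_open k U g \<Longrightarrow> Ck_open k U (\<lambda>x. f (g x))"
proof (induction k arbitrary: f)
  case 0
  then show ?case using assms(3) by (auto intro!: continuous_on_compose2[of V f U g])
next
  case (Suc k)
  let ?D = "\<lambda>x v. \<Sum>b\<in>Basis. (frechet_derivative g (at x) v \<bullet> b) *\<^sub>R frechet_derivative f (at (g x)) b"
  show ?case
  proof (rule Ck_openI[where D="?D"])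
    fix x assume x: "x \<in> U"
    note f = Ck_open_derivative[OF Suc.prems(1) assms(3)[OF x]]
    have "((\<lambda>x. f (g x)) has_derivative
        (\<lambda>v. frechet_derivative f (at (g x)) (frechet_derivative g (at x) v))) (at x)"
      using has_derivative_compose[OF Ck_open_derivative[OF Suc.prems(2) x] f] .
    moreover have "frechet_derivative f (at (g x)) (frechet_derivative g (at x) v) = ?D x v" for v
      by (rule linear_eq_sum_Basis) (use f has_derivative_linear in blast)
    ultimately show "((\<lambda>x. f (g x)) has_derivative ?D x) (at x)" by simp
  next
    fix v
    show "Ck_open k U (\<lambda>x. ?D x v)"
      using Suc.prems Ck_open_Suc_imp[OF Suc.prems(2)]
      by (intro Ck_open_sum Ck_open_scaleR Suc.IH assms
          Ck_open_compose_bounded_linear[OF _ bounded_linear_inner_left]) auto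
  qed (fact assms)
qed

lemma Ck_open_inverse:
  fixes h :: "'a::euclidean_space \<Rightarrow> real"
  assumes "open U" "\<And>x. x \<in> U \<Longrightarrow> h x \<noteq> 0"
  shows "Ck_open k U h \<Longrightarrow> Ck_open k U (\<lambda>x. inverse (h x))"
proof (induction k)
  case 0
  then show ?case using assms by (auto intro: continuous_intros)
next
  case (Suc k)
  note IH = Suc.IH[OF Ck_open_Suc_imp[OF Suc.prems]]
  show ?case
  proof (rule Ck_openI[where D="\<lambda>x v. (- 1) * (inverse (h x) * frechet_derivative h (at x) v * inverse (h x))"])
    fix x assume "x \<in> U"
    then show "((\<lambda>x. inverse (h x)) has_derivative
        (\<lambda>v. (- 1) * (inverse (h x) * frechet_derivative h (at x) v * inverse (h x)))) (at x)"
      using assms(2) Ck_open_derivative[OF Suc.prems] has_derivative_inverse by fastforce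
  next
    fix v
    show "Ck_open k U (\<lambda>x. (- 1) * (inverse (h x) * frechet_derivative h (at x) v * inverse (h x)))"
      using Suc.prems by (intro Ck_open_mult IH Ck_open_const assms(1)) auto
  qed (fact assms)
qed

lemma Ck_open_vec_lambda:
  fixes f :: "'i::finite \<Rightarrow> 'a::euclidean_space \<Rightarrow> 'b::euclidean_space"
  assumes "open U" "\<And>i. Ck_open k U (f i)"
  shows "Ck_open k U (\<lambda>x. \<chi> i. f i x)"
proof -
  have bl: "bounded_linear (axis i :: 'b \<Rightarrow> 'b ^ 'i)" for i
    unfolding linear_conv_bounded_linear[symmetric]
    by (intro linearI) (auto simp: axis_def vec_eq_iff)
  have "(\<lambda>x. \<chi> i. f i x) = (\<lambda>x. \<Sum>i\<in>UNIV. axis i (f i x))"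
    by (auto simp: vec_eq_iff axis_def if_distrib[of "\<lambda>z. z $ _"] fun_eq_iff)
  then show ?thesis
    using assms by (auto intro!: Ck_open_sum Ck_open_compose_bounded_linear[OF _ bl])
qed

lemma Ck_open_nth:
  assumes "open U" "Ck_open k U f"
  shows "Ck_open k U (\<lambda>x. f x $ i)"
  by (rule Ck_open_compose_bounded_linear[OF assms(1) bounded_linear_vec_nth assms(2)])

lemma Ck_open_Pair:
  fixes f :: "'a::euclidean_space \<Rightarrow> 'b::euclidean_space" and g :: "'a \<Rightarrow> 'c::euclidean_space"
  assumes "open U" "Ck_open k U f" "Ck_open k U g"
  shows "Ck_open k U (\<lambda>x. (f x, g x))"
proof -
  have "bounded_linear (\<lambda>y::'b. (y, 0::'c))" "bounded_linear (\<lambda>y::'c. (0::'b, y))"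
    by (auto intro!: bounded_linear_Pair bounded_linear_ident bounded_linear_zero)
  then have "Ck_open k U (\<lambda>x. (f x, 0) + (0, g x))"
    by (intro Ck_open_add[OF assms(1)] Ck_open_compose_bounded_linear[OF assms(1) _ assms(2)]
        Ck_open_compose_bounded_linear[OF assms(1) _ assms(3)])
  then show ?thesis by simp
qed

lemma Ck_open_det:
  fixes A :: "'a::euclidean_space \<Rightarrow> real ^ 'n ^ 'n"
  assumes "open U" "\<And>i j. Ck_open k U (\<lambda>x. A x $ i $ j)"
  shows "Ck_open k U (\<lambda>x. det (A x))"
  unfolding det_def using assms
  by (intro Ck_open_sum Ck_open_mult Ck_open_prod Ck_open_const) auto

text \<open>By Cramer's rule, the solution of a linear system is as smooth as its coefficients.\<close>

lemma Ck_open_linear_solution: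
  fixes A :: "'a::euclidean_space \<Rightarrow> real ^ 'n ^ 'n"
  assumes "open U" "\<And>i j. Ck_open k U (\<lambda>x. A x $ i $ j)" "Ck_open k U b"
    and "\<And>x. x \<in> U \<Longrightarrow> det (A x) \<noteq> 0" "\<And>x. x \<in> U \<Longrightarrow> A x *v y x = b x"
  shows "Ck_open k U y"
proof -
  have "y x = (\<chi> k. det (\<chi> i j. if j = k then b x $ i else A x $ i $ j) * inverse (det (A x)))"
    if "x \<in> U" for x
    using cramer[OF assms(4)[OF that]] assms(5)[OF that] by (simp add: divide_inverse)
  moreover have "Ck_open k U (\<lambda>x. det (\<chi> i j. if j = l then b x $ i else A x $ i $ j))" for l
  proof (rule Ck_open_det[OF assms(1)])
    show "Ck_open k U (\<lambda>x. (\<chi> i j. if j = l then b x $ i else A x $ i $ j) $ i $ j)" for i j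
      using assms(2) Ck_open_nth[OF assms(1,3)] by (cases "j = l") auto
  qed
  then have "Ck_open k U
      (\<lambda>x. \<chi> k. det (\<chi> i j. if j = k then b x $ i else A x $ i $ j) * inverse (det (A x)))"
    by (intro Ck_open_vec_lambda[OF assms(1)] Ck_open_mult[OF assms(1)]
        Ck_open_inverse[OF assms(1) assms(4)] Ck_open_det[OF assms(1,2)])
  ultimately show ?thesis
    using Ck_open_cong[OF assms(1), of y] by simp
qed

lemma Cp_open_compose:
  assumes "open U" "open V" "\<And>x. x \<in> U \<Longrightarrow> g x \<in> V" "Cp_open p V f" "Cp_open p U g"
  shows "Cp_open p U (\<lambda>x. f (g x))"
  using assms Ck_open_compose[of U V g] unfolding Cp_open_def by blast

lemma Cp_open_subset: "Cp_open p U f \<Longrightarrow> V \<subseteq> U \<Longrightarrow> Cp_open p V f"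
  unfolding Cp_open_def using Ck_open_subset by blast

lemma Cp_open_mono: "Cp_open p U f \<Longrightarrow> q \<le> p \<Longrightarrow> Cp_open q U f"
  unfolding Cp_open_def using order_trans by blast

lemma Cp_on_compose:
  assumes "Cp_on p S f" "Cp_open p UNIV c" "c ` V \<subseteq> S"
  shows "Cp_on p V (\<lambda>x. f (c x))"
  unfolding Cp_on_def
proof
  fix x assume "x \<in> V"
  then obtain U g where U: "open U" "c x \<in> U" "Cp_open p U g" "\<forall>y\<in>U \<inter> S. g y = f y"
    using assms(1,3) unfolding Cp_on_def by blast
  have "continuous_on UNIV c"
    using assms(2) unfolding Cp_open_def by (metis Ck_open.simps(1) i0_lb zero_enat_def)
  then have o: "open (c -` U)"
    using U(1) by (simp add: open_vimage)
  have "Cp_open p (c -` U) (\<lambda>x. g (c x))"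
    by (rule Cp_open_compose[where f=g and g=c, OF o U(1) _ U(3) Cp_open_subset[OF assms(2)]]) auto
  with o U(2,4) assms(3) show "\<exists>U' g'. open U' \<and> x \<in> U' \<and> Cp_open p U' g' \<and> (\<forall>y\<in>U' \<inter> V. g' y = f (c y))"
    by (intro exI[of _ "c -` U"] exI[of _ "\<lambda>x. g (c x)"]) auto
qed

section \<open>The implicit function theorem in class \<open>C\<^sup>p\<close>\<close>

text \<open>The inverse function theorem asks for a derivative that is continuous in operator norm;
  in finite dimension continuity in every fixed direction implies this.\<close>

lemma Ck_open_1_blinfun:
  assumes "open U" "Ck_open (Suc 0) U F"
  shows "continuous_on U (\<lambda>x. Blinfun (frechet_derivative F (at x)))"
    and "\<And>x. x \<in> U \<Longrightarrow> blinfun_apply (Blinfun (frechet_derivative F (at x))) = frechet_derivative F (at x)"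
proof -
  show 1: "\<And>x. x \<in> U \<Longrightarrow> blinfun_apply (Blinfun (frechet_derivative F (at x))) = frechet_derivative F (at x)"
    using Ck_open_derivative[OF assms(2)] has_derivative_bounded_linear bounded_linear_Blinfun_apply
    by blast
  show "continuous_on U (\<lambda>x. Blinfun (frechet_derivative F (at x)))"
    using assms(2) by (intro continuous_on_blinfun_componentwise) (simp add: 1 cong: continuous_on_cong)
qed

lemma Ck_open_frechet_derivative:
  "Ck_open (Suc k) U f \<Longrightarrow> Ck_open k U (\<lambda>x. frechet_derivative f (at x) v)"
  by simp

text \<open>The inverse function theorem is applied to \<open>G (w, x) = (w, F (w, x))\<close>, and
  \<open>\<phi>\<close> is read off from the inverse on the slice \<open>(w, 0)\<close>. This gives
  differentiability; the full class \<open>C^p\<close> is then bootstrapped from the linear system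
  that the derivative of \<open>\<phi>\<close> solves.\<close>

lemma implicit_function:
  fixes F :: "'w::euclidean_space \<times> (real ^ 'n) \<Rightarrow> real ^ 'n"
  assumes "open U" "Cp_open p U F" "1 \<le> p" "(w0, x0) \<in> U" "F (w0, x0) = 0"
    and inj: "\<And>b. frechet_derivative F (at (w0, x0)) (0, b) = 0 \<Longrightarrow> b = 0"
  obtains W \<phi> where "open W" "w0 \<in> W" "\<phi> w0 = x0" "Cp_open p W \<phi>"
    "\<And>w. w \<in> W \<Longrightarrow> (w, \<phi> w) \<in> U \<and> F (w, \<phi> w) = 0"
proof -
  let ?D = "\<lambda>z. frechet_derivative F (at z)"
  define G where "G z = (fst z, F z)" for z
  have C1: "Ck_open (Suc 0) U F"
    using assms(2,3) unfolding Cp_open_def one_enat_def One_nat_def by blast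
  have dF: "(F has_derivative ?D z) (at z)" if "z \<in> U" for z
    using Ck_open_derivative[OF C1 that] .
  have dG: "(G has_derivative (\<lambda>v. (fst v, ?D z v))) (at z)" if "z \<in> U" for z
    unfolding G_def[abs_def] using dF[OF that] by (auto intro!: derivative_eq_intros)
  then have fdG: "frechet_derivative G (at z) = (\<lambda>v. (fst v, ?D z v))" if "z \<in> U" for z
    using frechet_derivative_at[OF dG[OF that]] by simp
  have C1G: "Ck_open (Suc 0) U G"
    unfolding G_def[abs_def]
    by (intro Ck_open_Pair C1 \<open>open U\<close> Ck_open_bounded_linear bounded_linear_fst)
  note bl = Ck_open_1_blinfun[OF \<open>open U\<close> C1G]
  let ?G' = "\<lambda>z. Blinfun (frechet_derivative G (at z))"
  have lin: "linear (\<lambda>v. (fst v, ?D z v))" if "z \<in> U" for z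
    using dG[OF that] has_derivative_linear by blast
  have "v = 0" if "(fst v, ?D (w0, x0) v) = 0" for v
  proof -
    from that have "fst v = 0" "?D (w0, x0) v = 0" by (simp_all add: zero_prod_def)
    then show "v = 0"
      using inj[of "snd v"] by (metis prod.collapse zero_prod_def)
  qed
  then have "inj (\<lambda>v. (fst v, ?D (w0, x0) v))"
    using linear_injective_0[THEN iffD2, OF lin[OF \<open>(w0, x0) \<in> U\<close>]] by blast
  then obtain I where I: "linear I" "\<And>v. I (fst v, ?D (w0, x0) v) = v"
    using linear_injective_left_inverse[OF lin[OF \<open>(w0, x0) \<in> U\<close>]] unfolding o_def id_def fun_eq_iff
    by blast
  have invf: "Blinfun I o\<^sub>L ?G' (w0, x0) = id_blinfun"
    using I bl(2)[OF \<open>(w0, x0) \<in> U\<close>] fdG[OF \<open>(w0, x0) \<in> U\<close>]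
    by (intro blinfun_eqI)
      (simp add: bounded_linear_Blinfun_apply linear_conv_bounded_linear)
  have dG': "(G has_derivative blinfun_apply (?G' z)) (at z)" if "z \<in> U" for z
    using dG[OF that] fdG[OF that] bl(2)[OF that] by simp
  obtain U' V g g' where IFT: "open U'" "U' \<subseteq> U" "(w0, x0) \<in> U'" "open V" "G (w0, x0) \<in> V"
    "homeomorphism U' V G g" "\<And>y. y \<in> V \<Longrightarrow> (g has_derivative (g' y)) (at y)"
    "\<And>y. y \<in> V \<Longrightarrow> bij (blinfun_apply (?G' (g y)))"
    by (rule inverse_function_theorem[OF \<open>open U\<close> _ bl(1) \<open>(w0, x0) \<in> U\<close> invf])
      (use dG' in blast)+
  define W where "W = (\<lambda>w. (w, 0)) -` V"
  define \<phi> where "\<phi> w = snd (g (w, 0))" for w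
  have W: "open W"
    unfolding W_def using \<open>open V\<close> by (intro open_vimage) (auto intro: continuous_intros)
  have gw: "g (w, 0) = (w, \<phi> w)" "(w, \<phi> w) \<in> U" "F (w, \<phi> w) = 0" if "w \<in> W" for w
  proof -
    have "(w, 0) \<in> V" using that by (simp add: W_def)
    then have "G (g (w, 0)) = (w, 0)" "g (w, 0) \<in> U"
      using IFT(2,6) unfolding homeomorphism_def by blast+
    moreover from this show "g (w, 0) = (w, \<phi> w)"
      by (simp add: G_def \<phi>_def prod_eq_iff)
    ultimately show "(w, \<phi> w) \<in> U" "F (w, \<phi> w) = 0"
      by (simp_all add: G_def)
  qed
  have w0: "w0 \<in> W" "\<phi> w0 = x0"
  proof -
    have "G (w0, x0) = (w0, 0)" using assms(5) by (simp add: G_def)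
    moreover have "g (G (w0, x0)) = (w0, x0)"
      using IFT(3,6) unfolding homeomorphism_def by blast
    ultimately show "w0 \<in> W" "\<phi> w0 = x0"
      using IFT(5) by (simp_all add: W_def \<phi>_def)
  qed
  have d\<phi>: "\<phi> differentiable (at w)" if "w \<in> W" for w
  proof -
    have "(g has_derivative g' (w, 0)) (at (w, 0))"
      using IFT(7) that unfolding W_def by simp
    then have "((\<lambda>w. snd (g (w, 0))) has_derivative (\<lambda>v. snd (g' (w, 0) (v, 0)))) (at w)"
      by (intro has_derivative_snd
          has_derivative_compose[OF has_derivative_Pair[OF has_derivative_ident has_derivative_const]])
    then show ?thesis
      unfolding \<phi>_def[abs_def] differentiable_def by blast
  qed
  let ?A = "\<lambda>w. matrix (\<lambda>b. ?D (w, \<phi> w) (0, b))"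
  let ?d\<phi> = "\<lambda>w. frechet_derivative \<phi> (at w)"
  have linD: "linear (\<lambda>b. ?D (w, \<phi> w) (0, b))" if "w \<in> W" for w
  proof -
    have "linear (\<lambda>b :: real ^ 'n. (0 :: 'w, b))" by (intro linearI) auto
    from linear_compose[OF this has_derivative_linear[OF dF[OF gw(2)[OF that]]]]
    show ?thesis by (simp add: o_def)
  qed
  have A: "?A w *v b = ?D (w, \<phi> w) (0, b)" if "w \<in> W" for w b
    using matrix_works[OF linear_matrix_vector_mul_eq[THEN iffD2, OF linD[OF that]]] by simp
  \<comment> \<open>The inverse function theorem makes the derivative of \<open>G\<close> invertible
    at every point of the graph, so the hypothesis \<open>inj\<close> at the single point
    \<open>(w0, x0)\<close> suffices.\<close>
  have detA: "det (?A w) \<noteq> 0" if "w \<in> W" for w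
  proof -
    have "inj (\<lambda>v. (fst v, ?D (w, \<phi> w) v))"
      using IFT(8)[of "(w, 0)"] bl(2)[OF gw(2)[OF that]] fdG[OF gw(2)[OF that]] gw(1)[OF that] that
      by (simp add: bij_def W_def)
    then have *: "\<And>v. (fst v, ?D (w, \<phi> w) v) = 0 \<Longrightarrow> v = 0"
      using linear_injective_0[THEN iffD1, OF lin[OF gw(2)[OF that]]] by blast
    have "b = 0" if "?A w *v b = 0" for b
      using *[of "(0, b)"] that A[OF \<open>w \<in> W\<close>, of b] by (simp add: zero_prod_def)
    then have "inj ((*v) (?A w))"
      using linear_injective_0[THEN iffD2, OF matrix_vector_mul_linear[of "?A w"]] by blast
    then show ?thesis
      by (metis invertible_det_nz invertible_left_inverse matrix_left_invertible_injective)
  qed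
  \<comment> \<open>Implicit differentiation of \<open>F (w, \<phi> w) = 0\<close>.\<close>
  have eq: "?A w *v ?d\<phi> w v = (- 1) *\<^sub>R ?D (w, \<phi> w) (v, 0)" if "w \<in> W" for w v
  proof -
    have "(\<phi> has_derivative ?d\<phi> w) (at w)"
      using d\<phi>[OF that] frechet_derivative_works by blast
    then have "((\<lambda>w. (w, \<phi> w)) has_derivative (\<lambda>v. (v, ?d\<phi> w v))) (at w)"
      by (intro has_derivative_Pair has_derivative_ident)
    then have "((\<lambda>w. F (w, \<phi> w)) has_derivative (\<lambda>v. ?D (w, \<phi> w) (v, ?d\<phi> w v))) (at w)"
      by (rule has_derivative_compose[where g=F and f="\<lambda>w. (w, \<phi> w)", OF _ dF[OF gw(2)[OF that]]])
    moreover have "((\<lambda>w. F (w, \<phi> w)) has_derivative (\<lambda>v. 0)) (at w)"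
      by (rule has_derivative_transform_within_open[OF has_derivative_const W that])
        (use gw in auto)
    ultimately have "(\<lambda>v. ?D (w, \<phi> w) (v, ?d\<phi> w v)) = (\<lambda>v. 0)"
      by (rule has_derivative_unique)
    then have "?D (w, \<phi> w) (v, ?d\<phi> w v) = 0" by (rule fun_cong)
    moreover have "?D (w, \<phi> w) (v, ?d\<phi> w v) = ?D (w, \<phi> w) (v, 0) + ?D (w, \<phi> w) (0, ?d\<phi> w v)"
      using linear_add[OF has_derivative_linear[OF dF[OF gw(2)[OF that]]], of "(v, 0)" "(0, ?d\<phi> w v)"]
      by simp
    ultimately show ?thesis
      unfolding A[OF that] by (simp add: add_eq_0_iff)
  qed
  have "Ck_open k W \<phi>" if "enat k \<le> p" for k
    using that
  proof (induction k)
    case 0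
    then show ?case
      using d\<phi> by (auto intro: differentiable_imp_continuous_on_set)
  next
    case (Suc k)
    have "enat k \<le> p"
      using Suc.prems by (meson enat_ord_simps(1) le_SucI order_refl order_trans)
    then have IH: "Ck_open k W \<phi>" by (rule Suc.IH)
    have F: "Ck_open (Suc k) U F"
      using assms(2) Suc.prems unfolding Cp_open_def by blast
    have DF: "Ck_open k W (\<lambda>w. ?D (w, \<phi> w) c)" for c
    proof (rule Ck_open_compose[where f="\<lambda>z. ?D z c" and g="\<lambda>w. (w, \<phi> w)", OF W \<open>open U\<close>])
      show "Ck_open k U (\<lambda>z. ?D z c)" using F by (rule Ck_open_frechet_derivative)
      show "Ck_open k W (\<lambda>w. (w, \<phi> w))"
        by (intro Ck_open_Pair W IH Ck_open_bounded_linear bounded_linear_ident)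
    qed (use gw in blast)
    \<comment> \<open>The coefficients and the right-hand side of the system contain
      \<open>\<phi>\<close> but not its derivative. Hence \<open>\<phi>\<close> of class
      \<open>C^k\<close> makes its derivative of class \<open>C^k\<close>.\<close>
    have "Ck_open k W (\<lambda>w. ?d\<phi> w v)" for v
    proof (rule Ck_open_linear_solution[OF W _ _ detA eq])
      show "Ck_open k W (\<lambda>w. ?A w $ i $ j)" for i j
        using Ck_open_nth[OF W DF] by (simp add: matrix_def)
      show "Ck_open k W (\<lambda>w. (- 1) *\<^sub>R ?D (w, \<phi> w) (v, 0))"
        by (intro Ck_open_scaleR Ck_open_const W DF)
    qed
    then show ?case using d\<phi> by simp
  qed
  then have "Cp_open p W \<phi>" unfolding Cp_open_def by blast
  with W w0 gw that show ?thesis by blast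
qed

section \<open>Hausdorff null sets\<close>

lemma hausdorff_nullI:
  assumes "s > 0"
    and "\<And>\<delta> \<epsilon>. \<delta> > 0 \<Longrightarrow> \<epsilon> > 0 \<Longrightarrow> \<exists>C :: nat \<Rightarrow> _. B \<subseteq> (\<Union>j. C j) \<and>
      (\<forall>j. bounded (C j) \<and> diameter (C j) \<le> \<delta>) \<and> (\<Sum>j. ennreal (diameter (C j) powr s)) \<le> ennreal \<epsilon>"
  shows "hausdorff_outer_measure s B = 0"
proof -
  have "hausdorff_pre s \<delta> B = 0" if "\<delta> > 0" for \<delta>
  proof -
    have "hausdorff_pre s \<delta> B \<le> 0 + ennreal \<epsilon>" if "\<epsilon> > 0" for \<epsilon>
    proof -
      obtain C :: "nat \<Rightarrow> _" where "B \<subseteq> (\<Union>j. C j)" "\<forall>j. bounded (C j) \<and> diameter (C j) \<le> \<delta>"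
        and *: "(\<Sum>j. ennreal (diameter (C j) powr s)) \<le> ennreal \<epsilon>"
        using assms(2)[OF \<open>\<delta> > 0\<close> \<open>\<epsilon> > 0\<close>] by blast
      then have "hausdorff_pre s \<delta> B \<le> (\<Sum>j. ennreal (diameter (C j) powr s))"
        unfolding hausdorff_pre_def by (intro INF_lower) auto
      with * show ?thesis by simp
    qed
    then have "hausdorff_pre s \<delta> B \<le> 0" by (rule ennreal_le_epsilon)
    then show ?thesis by simp
  qed
  then show ?thesis
    using assms(1) by (simp add: hausdorff_outer_measure_eq_SUP)
qed

lemma hausdorff_nullD:
  assumes "hausdorff_outer_measure s B = 0" "s > 0" "\<delta> > 0" "\<epsilon> > 0"
  shows "\<exists>C :: nat \<Rightarrow> _. B \<subseteq> (\<Union>j. C j) \<and>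
      (\<forall>j. bounded (C j) \<and> diameter (C j) \<le> \<delta>) \<and> (\<Sum>j. ennreal (diameter (C j) powr s)) \<le> \<epsilon>"
proof -
  have "hausdorff_pre s \<delta> B \<le> (SUP \<delta>\<in>{0<..}. hausdorff_pre s \<delta> B)"
    using assms(3) by (intro SUP_upper) auto
  also have "\<dots> = 0"
    using assms(1,2) by (simp add: hausdorff_outer_measure_eq_SUP)
  finally have "hausdorff_pre s \<delta> B < \<epsilon>"
    using assms(4) by (simp add: zero_less_iff_neq_zero)
  then show ?thesis
    unfolding hausdorff_pre_def INF_less_iff by (auto intro: less_imp_le)
qed

lemma hausdorff_null_subset:
  assumes "hausdorff_outer_measure s B = 0" "A \<subseteq> B" "s > 0"
  shows "hausdorff_outer_measure s A = 0"
proof (rule hausdorff_nullI[OF assms(3)])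
  fix \<delta> \<epsilon> :: real assume "\<delta> > 0" "\<epsilon> > 0"
  then have "\<exists>C :: nat \<Rightarrow> _. B \<subseteq> (\<Union>j. C j) \<and>
      (\<forall>j. bounded (C j) \<and> diameter (C j) \<le> \<delta>) \<and> (\<Sum>j. ennreal (diameter (C j) powr s)) \<le> ennreal \<epsilon>"
    by (intro hausdorff_nullD[OF assms(1,3)]) auto
  then show "\<exists>C :: nat \<Rightarrow> _. A \<subseteq> (\<Union>j. C j) \<and>
      (\<forall>j. bounded (C j) \<and> diameter (C j) \<le> \<delta>) \<and> (\<Sum>j. ennreal (diameter (C j) powr s)) \<le> ennreal \<epsilon>"
    using assms(2) order_trans by meson
qed

text \<open>The set with index \<open>n\<close> gets the budget \<open>\<epsilon> / 2^(n+1)\<close>,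
  and \<open>prod_decode\<close> merges the double sequence of covering sets into one.\<close>

lemma hausdorff_null_UN:
  assumes "\<And>n::nat. hausdorff_outer_measure s (B n) = 0" "s > 0"
  shows "hausdorff_outer_measure s (\<Union>n. B n) = 0"
proof (rule hausdorff_nullI[OF assms(2)])
  fix \<delta> \<epsilon> :: real assume pos: "\<delta> > 0" "\<epsilon> > 0"
  have "\<forall>n. \<exists>C :: nat \<Rightarrow> _. B n \<subseteq> (\<Union>j. C j) \<and> (\<forall>j. bounded (C j) \<and> diameter (C j) \<le> \<delta>) \<and>
      (\<Sum>j. ennreal (diameter (C j) powr s)) \<le> ennreal (\<epsilon> * (1/2) ^ Suc n)"
    using hausdorff_nullD[OF assms pos(1)] pos(2) by simp
  then obtain C :: "nat \<Rightarrow> nat \<Rightarrow> _" where C: "\<And>n. B n \<subseteq> (\<Union>j. C n j)"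
    "\<And>n j. bounded (C n j) \<and> diameter (C n j) \<le> \<delta>"
    "\<And>n. (\<Sum>j. ennreal (diameter (C n j) powr s)) \<le> ennreal (\<epsilon> * (1/2) ^ Suc n)"
    by metis
  define E where "E j = (case prod_decode j of (n, k) \<Rightarrow> C n k)" for j
  have "(\<Union>n. B n) \<subseteq> (\<Union>j. E j)"
  proof
    fix x assume "x \<in> (\<Union>n. B n)"
    then obtain n k where "x \<in> C n k" using C(1) by blast
    then have "x \<in> E (prod_encode (n, k))" by (simp add: E_def)
    then show "x \<in> (\<Union>j. E j)" by blast
  qed
  moreover have "(\<Sum>j. ennreal (diameter (E j) powr s)) \<le> ennreal \<epsilon>"
  proof -
    have "(\<Sum>j. ennreal (diameter (E j) powr s))
        = (\<Sum>j. (\<lambda>(n, k). ennreal (diameter (C n k) powr s)) (prod_decode j))"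
      by (intro arg_cong[where f=suminf]) (auto simp: E_def split: prod.split)
    also have "\<dots> = (\<Sum>n. \<Sum>k. ennreal (diameter (C n k) powr s))"
      by (rule suminf_ennreal_2dimen) simp
    also have "\<dots> \<le> (\<Sum>n. ennreal (\<epsilon> * (1/2) ^ Suc n))"
      by (intro suminf_le C(3)) auto
    also have "\<dots> = ennreal \<epsilon>"
      using sums_mult[OF power_half_series, of \<epsilon>] pos
      by (intro suminf_ennreal_eq) auto
    finally show ?thesis .
  qed
  moreover have "\<forall>j. bounded (E j) \<and> diameter (E j) \<le> \<delta>"
    using C(2) by (auto simp: E_def split: prod.split)
  ultimately show "\<exists>C :: nat \<Rightarrow> _. (\<Union>n. B n) \<subseteq> (\<Union>j. C j) \<and>
      (\<forall>j. bounded (C j) \<and> diameter (C j) \<le> \<delta>) \<and> (\<Sum>j. ennreal (diameter (C j) powr s)) \<le> ennreal \<epsilon>"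
    by blast
qed

lemma hausdorff_null_UN_finite:
  assumes "finite I" "\<And>i. i \<in> I \<Longrightarrow> hausdorff_outer_measure s (B i) = 0" "s > 0"
  shows "hausdorff_outer_measure s (\<Union>i\<in>I. B i) = 0"
proof (cases "I = {}")
  case True
  have "hausdorff_outer_measure s ({} :: 'b set) = 0"
    by (rule hausdorff_nullI[OF assms(3)], rule exI[of _ "\<lambda>_. {}"]) simp
  with True show ?thesis by simp
next
  case False
  then have "I = range (from_nat_into I)"
    using assms(1) by (simp add: countable_finite range_from_nat_into)
  then have "(\<Union>i\<in>I. B i) = (\<Union>n. B (from_nat_into I n))" by (metis image_image)
  then show ?thesis
    using assms(2) from_nat_into[OF False] hausdorff_null_UN[OF _ assms(3), of "\<lambda>n. B (from_nat_into I n)"]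
    by simp
qed

text \<open>With \<open>d = card D\<close>, a grid of mesh proportional to \<open>1/n\<close> covers
  the box by \<open>(n+1)^d\<close> cells whose images have diameter at most \<open>M/n\<close>. The
  covering sum is at most a constant times \<open>n^(d-s)\<close>, which tends to 0 because
  \<open>d < s\<close>.\<close>

lemma hausdorff_null_lipschitz_box:
  fixes T :: "'a::euclidean_space \<Rightarrow> 'b::euclidean_space"
  assumes "D \<subseteq> Basis" "real (card D) < s" "0 < R" "0 \<le> L"
    and K: "K = {x. (\<forall>b\<in>D. \<bar>x \<bullet> b\<bar> \<le> R) \<and> (\<forall>b\<in>Basis - D. x \<bullet> b = 0)}"
    and lip: "\<And>x y. x \<in> K \<Longrightarrow> y \<in> K \<Longrightarrow> dist (T x) (T y) \<le> L * dist x y"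
  shows "hausdorff_outer_measure s (T ` K) = 0"
proof (rule hausdorff_nullI)
  show "s > 0" using assms(2) by linarith
next
  fix \<delta> \<epsilon> :: real assume pos: "\<delta> > 0" "\<epsilon> > 0"
  define d where "d = card D"
  \<comment> \<open>Two points of one cell differ by at most \<open>4 * R / n\<close> in each of the
    \<open>d\<close> free coordinates, so their distance is at most the sum of these bounds;
    \<open>L\<close> is the Lipschitz constant.\<close>
  define M where "M = L * (d * (4 * R))"
  have fin: "finite D" using assms(1) finite_Basis finite_subset by blast
  have M: "M \<ge> 0" using assms(3,4) by (simp add: M_def)
  have "(\<lambda>n. M / real n) \<longlonglongrightarrow> 0"
    by (rule lim_const_over_n)
  then have ev1: "\<forall>\<^sub>F n in sequentially. M / real n < \<delta>"
    using pos(1) by (rule order_tendstoD)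
  have "(\<lambda>n. real n powr (real d - s)) \<longlonglongrightarrow> 0"
    using assms(2) by (intro tendsto_neg_powr filterlim_real_sequentially) (auto simp: d_def)
  then have "(\<lambda>n. (2 ^ d * M powr s) * real n powr (real d - s)) \<longlonglongrightarrow> 0"
    using tendsto_mult_right_zero by blast
  then have ev2: "\<forall>\<^sub>F n in sequentially. (2 ^ d * M powr s) * real n powr (real d - s) < \<epsilon>"
    using pos(2) by (rule order_tendstoD)
  obtain n where n: "n \<ge> 1" "M / real n < \<delta>" "(2 ^ d * M powr s) * real n powr (real d - s) < \<epsilon>"
    using eventually_conj[OF ev1 eventually_conj[OF ev2 eventually_ge_at_top[of 1]]]
    by (auto simp: eventually_sequentially)
  \<comment> \<open>Indices run up to \<open>n\<close> inclusive: the floor equals \<open>n\<close>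
    at the right end of the interval. This costs the factor \<open>2^d\<close> from
    \<open>n + 1 \<le> 2 * n\<close>.\<close>
  define P where "P = (D \<rightarrow>\<^sub>E {..n})"
  define Q where "Q p = {x\<in>K. \<forall>b\<in>D. \<bar>x \<bullet> b - (2 * R * real (p b) / n - R)\<bar> \<le> 2 * R / n}" for p
  have finP: "finite P" and cardP: "card P = (n + 1) ^ d"
    using fin by (auto simp: P_def d_def card_PiE finite_PiE)
  have cover: "K \<subseteq> (\<Union>p\<in>P. Q p)"
  proof
    fix x assume x: "x \<in> K"
    define p where "p = (\<lambda>b\<in>D. nat \<lfloor>(x \<bullet> b + R) / (2 * R) * n\<rfloor>)"
    have "p b \<le> n \<and> \<bar>x \<bullet> b - (2 * R * real (p b) / n - R)\<bar> \<le> 2 * R / n" if "b \<in> D" for b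
    proof -
      define t where "t = (x \<bullet> b + R) / (2 * R)"
      have xb: "x \<bullet> b = 2 * R * t - R" using assms(3) by (simp add: t_def field_simps)
      have "\<bar>x \<bullet> b\<bar> \<le> R" using x that K by auto
      then have t: "0 \<le> t" "t \<le> 1" using assms(3) by (auto simp: t_def field_simps)
      have "p b = nat \<lfloor>t * n\<rfloor>"
        using that by (simp add: p_def t_def)
      then have pb: "real (p b) = of_int \<lfloor>t * n\<rfloor>"
        using t by simp
      have "t * n \<le> n" using t n(1) by (simp add: mult_left_le_one_le)
      then have "p b \<le> n" using pb by linarith
      moreover have "\<bar>t * n - p b\<bar> \<le> 1" using pb by linarith
      then have "\<bar>2 * R / n * (t * n - p b)\<bar> \<le> 2 * R / n * 1"
        unfolding abs_mult using assms(3) by (intro mult_mono) auto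
      moreover have "2 * R / n * (t * n - p b) = x \<bullet> b - (2 * R * real (p b) / n - R)"
        using n(1) by (simp add: xb field_simps)
      ultimately show ?thesis by (simp only: mult_1_right)
    qed
    then have "p \<in> P" "x \<in> Q p" using x by (auto simp: P_def Q_def p_def)
    then show "x \<in> (\<Union>p\<in>P. Q p)" by blast
  qed
  have small: "dist (T x) (T y) \<le> M / n" if "x \<in> Q p" "y \<in> Q p" for x y p
  proof -
    have b: "\<bar>(x - y) \<bullet> b\<bar> \<le> (if b \<in> D then 4 * R / n else 0)" if "b \<in> Basis" for b
    proof (cases "b \<in> D")
      case True
      then have "\<bar>x \<bullet> b - (2 * R * real (p b) / n - R)\<bar> \<le> 2 * R / n"
        "\<bar>y \<bullet> b - (2 * R * real (p b) / n - R)\<bar> \<le> 2 * R / n"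
        using \<open>x \<in> Q p\<close> \<open>y \<in> Q p\<close> by (auto simp: Q_def)
      then have "\<bar>x \<bullet> b - y \<bullet> b\<bar> \<le> 2 * R / n + 2 * R / n" by linarith
      also have "\<dots> = 4 * R / n" by (simp add: field_simps)
      finally show ?thesis using True by (simp add: inner_diff_left)
    next
      case False
      then show ?thesis using \<open>x \<in> Q p\<close> \<open>y \<in> Q p\<close> that by (auto simp: Q_def K inner_diff_left)
    qed
    have "dist x y \<le> (\<Sum>b\<in>Basis. \<bar>(x - y) \<bullet> b\<bar>)" unfolding dist_norm by (rule norm_le_l1)
    also have "\<dots> \<le> (\<Sum>b\<in>Basis. if b \<in> D then 4 * R / n else 0)" by (intro sum_mono b)
    also have "\<dots> = d * (4 * R / n)"
      using assms(1) by (simp add: sum.inter_restrict[symmetric] Int_absorb1 d_def)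
    finally have "L * dist x y \<le> L * (d * (4 * R / n))" using assms(4) by (intro mult_left_mono)
    also have "\<dots> = M / n" by (simp add: M_def)
    finally show ?thesis using lip[of x y] that by (auto simp: Q_def)
  qed
  have bd: "bounded (T ` Q p)" for p
  proof (cases "Q p = {}")
    case False
    then obtain y where "y \<in> Q p" by blast
    then have "T ` Q p \<subseteq> cball (T y) (M / n)" using small by auto
    then show ?thesis using bounded_cball bounded_subset by blast
  qed simp
  have diam: "diameter (T ` Q p) \<le> M / n" for p
    using small M by (intro diameter_le) (auto simp: dist_norm)
  obtain e where e: "bij_betw e {..<card P} P"
    using ex_bij_betw_nat_finite[OF finP] by (auto simp: atLeast0LessThan)
  define C where "C j = (if j < card P then T ` Q (e j) else {})" for j
  have "T ` K \<subseteq> (\<Union>j. C j)"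
  proof
    fix z assume "z \<in> T ` K"
    then obtain p where "p \<in> P" "z \<in> T ` Q p" using cover by blast
    moreover have "p \<in> e ` {..<card P}"
      using bij_betw_imp_surj_on[OF e] \<open>p \<in> P\<close> by simp
    then obtain j where "j < card P" "e j = p" by auto
    ultimately show "z \<in> (\<Union>j. C j)" by (auto simp: C_def)
  qed
  moreover have "bounded (C j) \<and> diameter (C j) \<le> \<delta>" for j
    using bd diam[of "e j"] n(2) pos(1) by (auto simp: C_def)
  moreover have "(\<Sum>j. ennreal (diameter (C j) powr s)) \<le> ennreal \<epsilon>"
  proof -
    have nn: "diameter (C j) \<ge> 0" for j
      using bd by (simp add: C_def diameter_ge_0)
    have le: "diameter (C j) \<le> M / n" if "j < card P" for j
      using diam that by (simp add: C_def)
    have "(\<Sum>j. ennreal (diameter (C j) powr s)) = (\<Sum>j<card P. ennreal (diameter (C j) powr s))"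
      by (intro suminf_finite) (auto simp: C_def)
    also have "\<dots> \<le> (\<Sum>j<card P. ennreal ((M / n) powr s))"
      using nn le assms(2) by (intro sum_mono ennreal_leI powr_mono2) auto
    also have "\<dots> = ennreal (card P * (M / n) powr s)"
      by (simp add: ennreal_mult ennreal_of_nat_eq_real_of_nat)
    also have "\<dots> \<le> ennreal \<epsilon>"
    proof (rule ennreal_leI)
      have "real (card P) \<le> (2 * real n) ^ d"
        unfolding cardP of_nat_power using n(1) by (intro power_mono) auto
      then have "card P * (M / n) powr s \<le> (2 * real n) ^ d * (M / n) powr s"
        by (intro mult_right_mono) auto
      also have "\<dots> = (2 ^ d * M powr s) * real n powr (real d - s)"
        using n(1) M by (simp add: power_mult_distrib powr_divide powr_diff powr_realpow)
      finally show "card P * (M / n) powr s \<le> \<epsilon>" using n(3) by simp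
    qed
    finally show ?thesis .
  qed
  ultimately show "\<exists>C :: nat \<Rightarrow> _. T ` K \<subseteq> (\<Union>j. C j) \<and>
      (\<forall>j. bounded (C j) \<and> diameter (C j) \<le> \<delta>) \<and> (\<Sum>j. ennreal (diameter (C j) powr s)) \<le> ennreal \<epsilon>"
    by blast
qed

text \<open>The sum of the norms of the partial derivatives is continuous, hence bounded on
  \<open>S\<close>, and it dominates the operator norm; convexity lets the mean value inequality
  turn this into a Lipschitz bound.\<close>

lemma C1_lipschitz_on_compact_convex:
  fixes T :: "'a::euclidean_space \<Rightarrow> 'b::euclidean_space"
  assumes "Ck_open (Suc 0) UNIV T" "compact S" "convex S"
  obtains L where "L \<ge> 0" "\<And>x y. x \<in> S \<Longrightarrow> y \<in> S \<Longrightarrow> dist (T x) (T y) \<le> L * dist x y"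
proof -
  let ?D = "\<lambda>x. frechet_derivative T (at x)"
  let ?h = "\<lambda>x. \<Sum>b\<in>Basis. norm (?D x b)"
  have der: "(T has_derivative ?D x) (at x)" for x
    using Ck_open_derivative[OF assms(1)] by simp
  have "continuous_on S ?h"
    using assms(1) by (intro continuous_intros) (auto intro: continuous_on_subset)
  then have "bounded (?h ` S)"
    using compact_continuous_image assms(2) compact_imp_bounded by blast
  then obtain L where L: "L > 0" "\<And>x. x \<in> S \<Longrightarrow> norm (?h x) \<le> L"
    unfolding bounded_pos by auto
  have "onorm (?D x) \<le> L" if "x \<in> S" for x
  proof (rule onorm_bound)
    fix v
    have "norm (?D x v) = norm (\<Sum>b\<in>Basis. (v \<bullet> b) *\<^sub>R ?D x b)"
      using linear_eq_sum_Basis[OF has_derivative_linear[OF der]] by metis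
    also have "\<dots> \<le> (\<Sum>b\<in>Basis. \<bar>v \<bullet> b\<bar> * norm (?D x b))"
      using norm_sum[of "\<lambda>b. (v \<bullet> b) *\<^sub>R ?D x b" Basis] by simp
    also have "\<dots> \<le> (\<Sum>b\<in>Basis. norm v * norm (?D x b))"
      by (intro sum_mono mult_right_mono Basis_le_norm) auto
    also have "\<dots> = norm v * ?h x" by (simp add: sum_distrib_left)
    also have "\<dots> \<le> norm v * L" using L(2)[OF that] by (intro mult_left_mono) auto
    finally show "norm (?D x v) \<le> L * norm v" by (simp add: mult.commute)
  qed (use L in auto)
  then have "norm (T x - T y) \<le> L * norm (x - y)" if "x \<in> S" "y \<in> S" for x y
    using that by (intro differentiable_bound[OF assms(3) has_derivative_at_withinI[OF der]])
  then show thesis using L(1) by (intro that[of L]) (auto simp: dist_norm)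
qed

text \<open>The Lipschitz constant may grow without bound, so the coordinate subspace spanned by
  \<open>D\<close> is exhausted by countably many boxes, each with its own constant.\<close>

lemma hausdorff_null_C1_image:
  fixes T :: "'a::euclidean_space \<Rightarrow> 'b::euclidean_space"
  assumes "Ck_open (Suc 0) UNIV T" "D \<subseteq> Basis" "real (card D) < s"
  shows "hausdorff_outer_measure s (T ` {x. \<forall>b\<in>Basis - D. x \<bullet> b = 0}) = 0"
proof -
  have s: "s > 0" using assms(3) by linarith
  \<comment> \<open>\<open>Suc n\<close> instead of \<open>n\<close> keeps the half side length
    positive, as the estimate for a box requires.\<close>
  define K where "K n = {x :: 'a. (\<forall>b\<in>D. \<bar>x \<bullet> b\<bar> \<le> real (Suc n)) \<and> (\<forall>b\<in>Basis - D. x \<bullet> b = 0)}" for n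
  have null: "hausdorff_outer_measure s (T ` K n) = 0" for n
  proof -
    let ?S = "cbox (- real (Suc n) *\<^sub>R One) (real (Suc n) *\<^sub>R One) :: 'a set"
    obtain L where L: "L \<ge> 0" "\<And>x y. x \<in> ?S \<Longrightarrow> y \<in> ?S \<Longrightarrow> dist (T x) (T y) \<le> L * dist x y"
      using C1_lipschitz_on_compact_convex[OF assms(1) compact_cbox convex_box(1)] by metis
    have "K n \<subseteq> ?S"
    proof
      fix x assume x: "x \<in> K n"
      have "\<bar>x \<bullet> b\<bar> \<le> real (Suc n)" if "b \<in> Basis" for b
        using x that by (cases "b \<in> D") (auto simp: K_def)
      then show "x \<in> ?S"
        by (auto simp: mem_box abs_le_iff minus_le_iff[of "_ \<bullet> _"] simp del: of_nat_Suc)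
    qed
    then show ?thesis
      using L by (intro hausdorff_null_lipschitz_box[OF assms(2,3) _ L(1) K_def]) auto
  qed
  have "{x. \<forall>b\<in>Basis - D. x \<bullet> b = 0} \<subseteq> (\<Union>n. K n)"
  proof
    fix x :: 'a assume x: "x \<in> {x. \<forall>b\<in>Basis - D. x \<bullet> b = 0}"
    obtain n where "norm x \<le> real n" using real_arch_simple by blast
    then have "x \<in> K n"
      using x assms(2) Basis_le_norm[of _ x] by (force simp: K_def)
    then show "x \<in> (\<Union>n. K n)" by blast
  qed
  then have "T ` {x. \<forall>b\<in>Basis - D. x \<bullet> b = 0} \<subseteq> (\<Union>n. T ` K n)" by blast
  then show ?thesis
    by (rule hausdorff_null_subset[OF hausdorff_null_UN[of s "\<lambda>n. T ` K n", OF null s] _ s])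
qed

section \<open>Simplices and their charts\<close>

lemma simplex_face_mono: "I \<subseteq> J \<Longrightarrow> simplex_face I \<subseteq> simplex_face J"
  by (auto simp: simplex_face_def)

lemma axis_in_simplex_face: "i \<in> I \<Longrightarrow> axis i 1 \<in> simplex_face I"
  by (auto simp: simplex_face_def axis_def)

lemma convex_simplex_face: "convex (simplex_face I)"
  unfolding convex_def simplex_face_def
  by (auto simp: sum.distrib sum_distrib_left[symmetric])

lemma compact_simplex_face: "compact (simplex_face I)"
proof (rule compact_Int_closed[of "cbox 0 1" "simplex_face I", THEN back_subst[of compact]])
  have "0 \<le> w $ i \<and> w $ i \<le> 1" if "w \<in> simplex_face I" for w i
  proof -
    have "w $ i \<le> (\<Sum>i\<in>UNIV. w $ i)"
      using that by (intro member_le_sum) (auto simp: simplex_face_def)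
    then show ?thesis using that by (auto simp: simplex_face_def)
  qed
  then show "cbox 0 1 \<inter> simplex_face I = simplex_face I"
    by (auto simp: mem_box_cart)
  show "closed (simplex_face I)"
    unfolding simplex_face_def
    by (intro closed_Collect_conj closed_Collect_all closed_Collect_imp closed_Collect_eq
        closed_Collect_le continuous_intros) auto
qed auto

lemma simplex_face_positive:
  assumes "w \<in> simplex_face I"
  obtains i where "i \<in> I" "0 < w $ i"
proof -
  have "\<exists>i. w $ i \<noteq> 0"
  proof (rule ccontr)
    assume "\<not> ?thesis"
    then have "(\<Sum>i\<in>UNIV. w $ i) = 0" by simp
    then show False using assms by (simp add: simplex_face_def)
  qed
  then show thesis
    using assms that unfolding simplex_face_def by (force simp: less_le)
qed

lemma orthant_axis:
  "orthant ((\<lambda>k. axis k 1) ` K) = {y :: real ^ 'n. (\<forall>k\<in>K. 0 \<le> y $ k) \<and> (\<forall>k. k \<notin> K \<longrightarrow> y $ k = 0)}"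
proof -
  have "Basis - (\<lambda>k. axis k 1) ` K = (\<lambda>k. axis k (1::real) :: real ^ 'n) ` (- K)"
    by (auto simp: Basis_vec_def axis_eq_axis)
  then show ?thesis
    by (auto simp: orthant_def inner_axis)
qed

lemma span_axis_nth:
  assumes "y \<in> span ((\<lambda>k. axis k 1) ` K)" "k \<notin> K"
  shows "(y :: real ^ 'n) $ k = 0"
proof -
  have "subspace {y :: real ^ 'n. y $ k = 0}" by (auto simp: subspace_def)
  moreover have "(\<lambda>k. axis k 1) ` K \<subseteq> {y :: real ^ 'n. y $ k = 0}"
    using assms(2) by (auto simp: axis_def)
  ultimately show ?thesis using span_minimal assms(1) by blast
qed

text \<open>
  The chart of \<open>simplex_face I\<close> in which the coordinate with index \<open>i0\<close> is eliminated. The map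
  \<open>\<sigma>\<close> renames the coordinates: a chart of a Pareto set in \<open>real ^ 'm\<close> has to be defined on an
  orthant of \<open>real ^ 'm\<close>, not of \<open>real ^ 'l\<close>.
\<close>

definition simplex_chart :: "'l::finite set \<Rightarrow> 'l \<Rightarrow> ('l \<Rightarrow> 'n) \<Rightarrow> real ^ 'n \<Rightarrow> real ^ 'l" where
  "simplex_chart I i0 \<sigma> y =
     axis i0 1 + (\<Sum>i\<in>I - {i0}. y $ \<sigma> i *\<^sub>R (axis i 1 - axis i0 1))"

definition simplex_coord :: "'l::finite set \<Rightarrow> 'l \<Rightarrow> ('l \<Rightarrow> 'n) \<Rightarrow> real ^ 'l \<Rightarrow> real ^ 'n" where
  "simplex_coord I i0 \<sigma> w = (\<Sum>i\<in>I - {i0}. w $ i *\<^sub>R axis (\<sigma> i) 1)"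

definition chart_basis :: "'l::finite set \<Rightarrow> 'l \<Rightarrow> ('l \<Rightarrow> 'n) \<Rightarrow> (real ^ 'n) set" where
  "chart_basis I i0 \<sigma> = (\<lambda>k. axis k 1) ` \<sigma> ` (I - {i0})"

text \<open>The strict inequality keeps the eliminated coordinate \<open>i0\<close> positive. It
  makes the domain relatively open in the orthant, and the charts for the various \<open>i0\<close>
  together cover the face.\<close>

definition chart_domain :: "'l::finite set \<Rightarrow> 'l \<Rightarrow> ('l \<Rightarrow> 'n) \<Rightarrow> (real ^ 'n) set" where
  "chart_domain I i0 \<sigma> = orthant (chart_basis I i0 \<sigma>) \<inter> {y. (\<Sum>i\<in>I - {i0}. y $ \<sigma> i) < 1}"

text \<open>The same sum occurs as the linear part of the chart and as its derivative; the
  coordinates show that it is a zero-sum vector supported in \<open>I\<close> when \<open>i0\<close>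
  lies in \<open>I\<close>.\<close>

lemma tangent_nth:
  fixes a :: "'l::finite \<Rightarrow> real"
  shows "(\<Sum>i\<in>I - {i0}. a i *\<^sub>R (axis i 1 - axis i0 1)) $ j =
    (if j = i0 then - (\<Sum>i\<in>I - {i0}. a i) else if j \<in> I then a j else 0)"
proof -
  have "(\<Sum>i\<in>I - {i0}. a i *\<^sub>R (axis i 1 - axis i0 1)) $ j
      = (\<Sum>i\<in>I - {i0}. (if i = j then a i else 0) - (if j = i0 then a i else 0))"
    unfolding sum_component by (intro sum.cong) (auto simp: axis_def)
  also have "\<dots> = (if j \<in> I - {i0} then a j else 0) - (if j = i0 then \<Sum>i\<in>I - {i0}. a i else 0)"
    by (simp add: sum_subtractf)
  finally show ?thesis by auto
qed

lemma sum_face: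
  fixes I :: "'l::finite set"
  assumes "i0 \<in> I" "\<And>i. i \<notin> I \<Longrightarrow> a i = 0"
  shows "(\<Sum>i\<in>UNIV. a i) = a i0 + (\<Sum>i\<in>I - {i0}. a i :: real)"
proof -
  have "(\<Sum>i\<in>UNIV. a i) = (\<Sum>i\<in>I. a i)"
    using assms(2) by (intro sum.mono_neutral_right) auto
  then show ?thesis using assms(1) by (simp add: sum.remove)
qed

context
  fixes I :: "'l::finite set" and i0 :: 'l and \<sigma> :: "'l \<Rightarrow> 'n::finite"
  assumes i0: "i0 \<in> I" and inj: "inj \<sigma>"
begin

lemma simplex_chart_nth:
  "simplex_chart I i0 \<sigma> y $ j =
     (if j = i0 then 1 - (\<Sum>i\<in>I - {i0}. y $ \<sigma> i) else if j \<in> I then y $ \<sigma> j else 0)"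
  unfolding simplex_chart_def vector_add_component tangent_nth by (simp add: axis_def)

lemma simplex_coord_nth:
  "simplex_coord I i0 \<sigma> w $ k = (if k \<in> \<sigma> ` (I - {i0}) then w $ inv \<sigma> k else 0)"
proof -
  have "simplex_coord I i0 \<sigma> w $ k = (\<Sum>i\<in>I - {i0}. if \<sigma> i = k then w $ i else 0)"
    unfolding simplex_coord_def sum_component by (intro sum.cong) (auto simp: axis_def)
  also have "\<dots> = (if k \<in> \<sigma> ` (I - {i0}) then w $ inv \<sigma> k else 0)"
  proof (cases "k \<in> \<sigma> ` (I - {i0})")
    case True
    then obtain j where j: "j \<in> I - {i0}" "k = \<sigma> j" by blast
    have "(\<Sum>i\<in>I - {i0}. if \<sigma> i = k then w $ i else 0) = (\<Sum>i\<in>I - {i0}. if i = j then w $ i else 0)"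
      using j inj by (intro sum.cong) (auto dest: injD)
    then show ?thesis using j inj True by simp
  next
    case False
    then have "(\<Sum>i\<in>I - {i0}. if \<sigma> i = k then w $ i else 0) = 0"
      by (intro sum.neutral) auto
    with False show ?thesis by simp
  qed
  finally show ?thesis .
qed

lemma chart_domain_iff:
  "y \<in> chart_domain I i0 \<sigma> \<longleftrightarrow> (\<forall>i\<in>I - {i0}. 0 \<le> y $ \<sigma> i) \<and>
     (\<forall>k. k \<notin> \<sigma> ` (I - {i0}) \<longrightarrow> y $ k = 0) \<and> (\<Sum>i\<in>I - {i0}. y $ \<sigma> i) < 1"
  by (auto simp: chart_domain_def chart_basis_def orthant_axis)

lemma simplex_chart_mem:
  assumes "y \<in> chart_domain I i0 \<sigma>"
  shows "simplex_chart I i0 \<sigma> y \<in> simplex_face I" "0 < simplex_chart I i0 \<sigma> y $ i0"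
proof -
  have "(\<Sum>i\<in>UNIV. simplex_chart I i0 \<sigma> y $ i) = 1"
    using i0 by (subst sum_face[OF i0]) (auto simp: simplex_chart_nth)
  then show "simplex_chart I i0 \<sigma> y \<in> simplex_face I" "0 < simplex_chart I i0 \<sigma> y $ i0"
    using assms i0 unfolding simplex_face_def chart_domain_iff by (auto simp: simplex_chart_nth)
qed

lemma simplex_coord_chart:
  assumes "y \<in> chart_domain I i0 \<sigma>"
  shows "simplex_coord I i0 \<sigma> (simplex_chart I i0 \<sigma> y) = y"
  using assms inj unfolding chart_domain_iff
  by (auto simp: vec_eq_iff simplex_coord_nth simplex_chart_nth)

lemma simplex_chart_coord:
  assumes "w \<in> simplex_face I"
  shows "simplex_chart I i0 \<sigma> (simplex_coord I i0 \<sigma> w) = w"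
proof -
  have "(\<Sum>i\<in>I - {i0}. simplex_coord I i0 \<sigma> w $ \<sigma> i) = (\<Sum>i\<in>I - {i0}. w $ i)"
    using inj by (intro sum.cong) (auto simp: simplex_coord_nth)
  also have "\<dots> = 1 - w $ i0"
    using assms sum_face[OF i0, of "($) w"] by (simp add: simplex_face_def)
  finally show ?thesis
    using assms inj by (auto simp: vec_eq_iff simplex_chart_nth simplex_coord_nth simplex_face_def)
qed

lemma simplex_coord_mem:
  assumes "w \<in> simplex_face I" "0 < w $ i0"
  shows "simplex_coord I i0 \<sigma> w \<in> chart_domain I i0 \<sigma>"
proof -
  have "simplex_chart I i0 \<sigma> (simplex_coord I i0 \<sigma> w) $ i0 = w $ i0"
    by (simp add: simplex_chart_coord[OF assms(1)])
  then have "(\<Sum>i\<in>I - {i0}. simplex_coord I i0 \<sigma> w $ \<sigma> i) < 1"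
    using assms(2) by (simp add: simplex_chart_nth)
  then show ?thesis
    using assms(1) inj unfolding chart_domain_iff by (auto simp: simplex_coord_nth simplex_face_def)
qed

lemma simplex_chart_image:
  "simplex_chart I i0 \<sigma> ` chart_domain I i0 \<sigma> = simplex_face I \<inter> {w. 0 < w $ i0}"
proof (intro equalityI subsetI)
  fix w assume "w \<in> simplex_face I \<inter> {w. 0 < w $ i0}"
  then show "w \<in> simplex_chart I i0 \<sigma> ` chart_domain I i0 \<sigma>"
    using simplex_chart_coord simplex_coord_mem by (metis IntE image_eqI mem_Collect_eq)
qed (use simplex_chart_mem in auto)

lemma has_derivative_simplex_chart:
  "(simplex_chart I i0 \<sigma> has_derivative
     (\<lambda>v. \<Sum>i\<in>I - {i0}. v $ \<sigma> i *\<^sub>R (axis i 1 - axis i0 1))) (at y within S)"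
  unfolding simplex_chart_def[abs_def]
  by (auto intro!: derivative_eq_intros bounded_linear.has_derivative[OF bounded_linear_vec_nth])

lemma Cp_open_simplex_chart: "Cp_open p UNIV (simplex_chart I i0 \<sigma>)"
  unfolding Cp_open_def simplex_chart_def[abs_def]
  by (intro allI impI Ck_open_add Ck_open_const Ck_open_sum Ck_open_scaleR Ck_open_bounded_linear
      bounded_linear_vec_nth open_UNIV)

lemma homeomorphism_simplex_chart:
  "homeomorphism (chart_domain I i0 \<sigma>) (simplex_face I \<inter> {w. 0 < w $ i0})
     (simplex_chart I i0 \<sigma>) (simplex_coord I i0 \<sigma>)"
proof (rule homeomorphismI)
  show "continuous_on (chart_domain I i0 \<sigma>) (simplex_chart I i0 \<sigma>)"
    using has_derivative_simplex_chart by (rule has_derivative_continuous_on)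
  show "continuous_on (simplex_face I \<inter> {w. 0 < w $ i0}) (simplex_coord I i0 \<sigma>)"
    unfolding simplex_coord_def[abs_def] by (intro continuous_intros)
qed (use simplex_chart_mem simplex_chart_coord simplex_coord_mem simplex_coord_chart in auto)

end

text \<open>The vectors \<open>v\<close> in the next definition form the tangent space of the face.\<close>

definition face_immersion :: "enat \<Rightarrow> 'l::finite set \<Rightarrow> (real ^ 'l \<Rightarrow> 'b::euclidean_space) \<Rightarrow> bool" where
  "face_immersion p I H \<longleftrightarrow> Cp_on p (simplex_face I) H \<and>
     (\<forall>w\<in>simplex_face I. \<exists>D. (H has_derivative D) (at w within simplex_face I) \<and>
        (\<forall>v. (\<Sum>i\<in>UNIV. v $ i) = 0 \<longrightarrow> (\<forall>i. i \<notin> I \<longrightarrow> v $ i = 0) \<longrightarrow> D v = 0 \<longrightarrow> v = 0))"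

text \<open>The chart is affine, and its derivative maps
  \<open>span (chart_basis I i0 \<sigma>)\<close> injectively into the tangent space of the face.
  Injectivity of the derivative of \<open>H\<close> on that tangent space therefore passes to the
  composition.\<close>

lemma face_immersion_chart:
  fixes \<sigma> :: "'l::finite \<Rightarrow> 'n::finite"
  assumes "i0 \<in> I" "inj \<sigma>" "face_immersion p I H"
  shows "Cp_on p (chart_domain I i0 \<sigma>) (H \<circ> simplex_chart I i0 \<sigma>)"
    and "y \<in> chart_domain I i0 \<sigma> \<Longrightarrow> \<exists>D. ((H \<circ> simplex_chart I i0 \<sigma>) has_derivative D)
           (at y within chart_domain I i0 \<sigma>) \<and> inj_on D (span (chart_basis I i0 \<sigma>))"
proof -
  let ?c = "simplex_chart I i0 \<sigma>" and ?V = "chart_domain I i0 \<sigma>"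
  let ?c' = "\<lambda>v :: real ^ 'n. \<Sum>i\<in>I - {i0}. v $ \<sigma> i *\<^sub>R (axis i 1 - axis i0 1) :: real ^ 'l"
  note image = simplex_chart_image[OF assms(1,2)]
  show "Cp_on p ?V (H \<circ> ?c)"
    using assms(3) image unfolding face_immersion_def comp_def
    by (intro Cp_on_compose[OF _ Cp_open_simplex_chart[OF assms(1,2)]]) auto
  assume y: "y \<in> ?V"
  then have cy: "?c y \<in> simplex_face I" using simplex_chart_mem[OF assms(1,2)] by blast
  then obtain D where D: "(H has_derivative D) (at (?c y) within simplex_face I)"
    "\<And>v. (\<Sum>i\<in>UNIV. v $ i) = 0 \<Longrightarrow> (\<And>i. i \<notin> I \<Longrightarrow> v $ i = 0) \<Longrightarrow> D v = 0 \<Longrightarrow> v = 0"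
    using assms(3) unfolding face_immersion_def by blast
  have "(H has_derivative D) (at (?c y) within ?c ` ?V)"
    using D(1) by (rule has_derivative_subset) (use image in blast)
  then have der: "((H \<circ> ?c) has_derivative (D \<circ> ?c')) (at y within ?V)"
    by (intro diff_chain_within has_derivative_simplex_chart assms(1,2))
  have "v = 0" if v: "v \<in> span (chart_basis I i0 \<sigma>)" "(D \<circ> ?c') v = 0" for v
  proof -
    have "?c' v = 0"
    proof (rule D(2))
      show "(\<Sum>i\<in>UNIV. ?c' v $ i) = 0"
        using assms(1) by (subst sum_face[OF assms(1)]) (auto simp: tangent_nth simp del: sum_component)
    qed (use v(2) assms(1) in \<open>auto simp: tangent_nth simp del: sum_component\<close>)
    then have "v $ \<sigma> i = 0" if "i \<in> I - {i0}" for i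
      using that tangent_nth[of "\<lambda>i. v $ \<sigma> i" i0 I i] by auto
    moreover have "v $ k = 0" if "k \<notin> \<sigma> ` (I - {i0})" for k
      using span_axis_nth[OF v(1)[unfolded chart_basis_def] that] .
    ultimately show "v = 0" by (metis imageE vec_eq_iff zero_index)
  qed
  then have "inj_on (D \<circ> ?c') (span (chart_basis I i0 \<sigma>))"
    using linear_injective_on_subspace_0[OF has_derivative_linear[OF der] subspace_span] by blast
  with der show "\<exists>D. ((H \<circ> ?c) has_derivative D) (at y within ?V) \<and> inj_on D (span (chart_basis I i0 \<sigma>))"
    by blast
qed

text \<open>Composing simplex charts with a homeomorphic immersion \<open>H\<close> yields charts of
  its image. Applied to \<open>\<Phi>\<close>, this is what makes a Pareto set a manifold with
  corners.\<close>

lemma corner_chart_simplex: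
  fixes H :: "real ^ 'l::finite \<Rightarrow> real ^ 'n"
  assumes "i0 \<in> I" "inj \<sigma>" "face_immersion p I H" "homeomorphism (simplex_face I) N H H'"
  shows "corner_chart p N (chart_basis I i0 \<sigma>) (chart_domain I i0 \<sigma>) (H \<circ> simplex_chart I i0 \<sigma>)"
proof -
  let ?c = "simplex_chart I i0 \<sigma>" and ?V = "chart_domain I i0 \<sigma>"
  let ?F = "simplex_face I \<inter> {w. 0 < w $ i0}"
  have im: "(H \<circ> ?c) ` ?V = H ` ?F"
    by (simp only: image_comp[symmetric] simplex_chart_image[OF assms(1,2)])
  have "open {y :: real ^ 'n. (\<Sum>i\<in>I - {i0}. y $ \<sigma> i) < 1}" "open {w :: real ^ 'l. 0 < w $ i0}"
    by (intro open_Collect_less continuous_intros)+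
  then have op: "openin (top_of_set (orthant (chart_basis I i0 \<sigma>))) ?V"
    "openin (top_of_set (simplex_face I)) ?F"
    unfolding chart_domain_def by (simp_all add: openin_open_Int)
  have "homeomorphism ?V (H ` ?F) (H \<circ> ?c) (simplex_coord I i0 \<sigma> \<circ> H')"
    by (rule homeomorphism_compose[OF homeomorphism_simplex_chart[OF assms(1,2)]
          homeomorphism_of_subsets[OF assms(4)]]) auto
  moreover have "openin (top_of_set N) (H ` ?F)"
    using homeomorphism_imp_open_map[OF assms(4) op(2)] .
  moreover have "chart_basis I i0 \<sigma> \<subseteq> Basis"
    by (auto simp: chart_basis_def axis_in_Basis_iff)
  ultimately show ?thesis
    unfolding corner_chart_def im
    using op(1) face_immersion_chart[OF assms(1-3)] by blast
qed

text \<open>Immersivity on a parametrised set \<open>N\<close> is tested on the parameter face. It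
  serves twice: for \<open>\<Phi>\<close> on a face, parametrised by the identity, and for
  \<open>g\<close> on a Pareto set, parametrised by \<open>\<Phi>\<close>.\<close>

lemma Cp_immersion_simplex:
  fixes H :: "real ^ 'l::finite \<Rightarrow> real ^ 'n" and \<sigma> :: "'l \<Rightarrow> 'n"
  assumes "inj \<sigma>" "face_immersion p I H" "homeomorphism (simplex_face I) N H H'"
    and "face_immersion p I (h \<circ> H)"
  shows "Cp_immersion p N h"
  unfolding Cp_immersion_def
proof
  fix x assume "x \<in> N"
  then have w: "H' x \<in> simplex_face I" "H (H' x) = x"
    using assms(3) unfolding homeomorphism_def by blast+
  \<comment> \<open>Eliminating a positive coordinate puts the point inside the domain of the
    chart.\<close>
  obtain i0 where i0: "i0 \<in> I" "0 < H' x $ i0" using simplex_face_positive[OF w(1)] .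
  let ?c = "simplex_chart I i0 \<sigma>" and ?y = "simplex_coord I i0 \<sigma> (H' x)"
  have y: "?y \<in> chart_domain I i0 \<sigma>" "(H \<circ> ?c) ?y = x"
    using simplex_coord_mem[OF i0(1) assms(1) w(1) i0(2)] simplex_chart_coord[OF i0(1) assms(1) w(1)] w(2)
    by simp_all
  note immer = face_immersion_chart[OF i0(1) assms(1,4)]
  obtain D where "((h \<circ> (H \<circ> ?c)) has_derivative D) (at ?y within chart_domain I i0 \<sigma>)"
    "inj_on D (span (chart_basis I i0 \<sigma>))"
    using immer(2)[OF y(1)] by (auto simp: comp_assoc)
  moreover have "Cp_on p (chart_domain I i0 \<sigma>) (h \<circ> (H \<circ> ?c))"
    using immer(1) by (simp add: comp_assoc)
  ultimately show "\<exists>B V \<psi> y D. corner_chart p N B V \<psi> \<and> y \<in> V \<and> \<psi> y = x \<and> Cp_on p V (h \<circ> \<psi>) \<and>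
        ((h \<circ> \<psi>) has_derivative D) (at y within V) \<and> inj_on D (span B)"
    using corner_chart_simplex[OF i0(1) assms(1-3)] y by blast
qed

lemma face_immersion_ident: "face_immersion p I (\<lambda>w. w)"
proof -
  have "Cp_on p (simplex_face I) (\<lambda>w. w)"
    unfolding Cp_on_def Cp_open_def
    using Ck_open_bounded_linear[OF open_UNIV bounded_linear_ident] by blast
  then show ?thesis
    unfolding face_immersion_def using has_derivative_ident by blast
qed

lemma Cp_map_simplex:
  assumes "p \<noteq> 0" "face_immersion p UNIV H" "H ` simplex_face UNIV \<subseteq> N"
  shows "Cp_map p (simplex_face UNIV) N H"
proof -
  have "\<exists>B V \<psi>. corner_chart p (simplex_face UNIV) B V \<psi> \<and> x \<in> \<psi> ` V \<and> Cp_on p V (H \<circ> \<psi>)"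
    if x: "x \<in> simplex_face UNIV" for x
  proof -
    obtain i0 where i0: "i0 \<in> UNIV" "0 < x $ i0" using simplex_face_positive[OF x] .
    let ?c = "simplex_chart UNIV i0 id"
    have "corner_chart p (simplex_face UNIV) (chart_basis UNIV i0 id) (chart_domain UNIV i0 id) ?c"
      using corner_chart_simplex[OF i0(1) inj_on_id face_immersion_ident homeomorphism_ident]
      by (simp add: comp_def)
    moreover have "x \<in> ?c ` chart_domain UNIV i0 id"
      unfolding simplex_chart_image[OF i0(1) inj_on_id] using x i0(2) by blast
    ultimately show ?thesis
      using face_immersion_chart(1)[OF i0(1) inj_on_id assms(2)] by blast
  qed
  then show ?thesis using assms(1,3) unfolding Cp_map_def by auto
qed

section \<open>Strongly convex mappings\<close>

definition jac :: "(real ^ 'm \<Rightarrow> real ^ 'l) \<Rightarrow> real ^ 'm \<Rightarrow> real ^ 'm ^ 'l" where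
  "jac g x = matrix (frechet_derivative g (at x))"

lemma has_derivative_jac:
  assumes "g differentiable (at x)"
  shows "(g has_derivative (*v) (jac g x)) (at x)"
proof -
  have der: "(g has_derivative frechet_derivative g (at x)) (at x)"
    using assms frechet_derivative_works by blast
  have "frechet_derivative g (at x) = (*v) (jac g x)"
    unfolding jac_def
    using matrix_works[OF linear_matrix_vector_mul_eq[THEN iffD2, OF has_derivative_linear[OF der]]]
    by (intro ext) simp
  with der show ?thesis by simp
qed

lemma has_derivative_jac_nth:
  assumes "g differentiable (at x)"
  shows "((\<lambda>x. g x $ i) has_derivative (\<lambda>v. jac g x $ i \<bullet> v)) (at x)"
  using bounded_linear.has_derivative[OF bounded_linear_vec_nth has_derivative_jac[OF assms], of i]
  by (simp add: matrix_vector_mul_component)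

lemma jac_unique:
  assumes "(g has_derivative (*v) A) (at x)"
  shows "jac g x = A"
  using frechet_derivative_at[OF assms] unfolding jac_def by (metis matrix_of_matrix_vector_mul)

lemma Ck_open_jac:
  assumes "Ck_open (Suc k) UNIV g"
  shows "Ck_open k UNIV (jac g)"
proof -
  have "Ck_open k UNIV (\<lambda>x. \<chi> i j. frechet_derivative g (at x) (axis j 1) $ i)"
    by (intro Ck_open_vec_lambda Ck_open_nth Ck_open_frechet_derivative[OF assms] open_UNIV)
  then show ?thesis unfolding jac_def[abs_def] matrix_def .
qed

lemma Cp_open_jac:
  assumes "Cp_open r UNIV g" "2 \<le> r"
  shows "Cp_open (r - 1) UNIV (jac g)"
  unfolding Cp_open_def
proof (intro allI impI)
  fix k assume "enat k \<le> r - 1"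
  then have "enat (Suc k) \<le> r"
    using assms(2) by (cases r) (auto simp: one_enat_def numeral_eq_enat)
  then show "Ck_open k UNIV (jac g)"
    using assms(1) Ck_open_jac unfolding Cp_open_def by blast
qed

text \<open>Apply the convexity inequality to \<open>t *\<^sub>R y + (1 - t) *\<^sub>R x\<close>,
  divide by \<open>t\<close> and let \<open>t\<close> decrease to 0; the factor \<open>1 - t\<close>
  of the quadratic term tends to 1.\<close>

lemma strongly_convex_gradient_ineq:
  fixes h :: "'a::euclidean_space \<Rightarrow> real"
  assumes conv: "\<And>x y t. t \<in> {0..1} \<Longrightarrow> h (t *\<^sub>R x + (1 - t) *\<^sub>R y)
      \<le> t * h x + (1 - t) * h y - 1 / 2 * \<alpha> * t * (1 - t) * (norm (x - y))\<^sup>2"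
    and der: "(h has_derivative D) (at x)"
  shows "h x + D (y - x) + \<alpha> / 2 * (norm (y - x))\<^sup>2 \<le> h y"
proof -
  have "((\<lambda>t. x + t *\<^sub>R (y - x)) has_derivative (\<lambda>t. t *\<^sub>R (y - x))) (at 0)"
    by (auto intro!: derivative_eq_intros)
  then have "((\<lambda>t. h (x + t *\<^sub>R (y - x))) has_derivative (\<lambda>t. D (t *\<^sub>R (y - x)))) (at 0)"
    using der by (intro has_derivative_compose[where g=h and f="\<lambda>t. x + t *\<^sub>R (y - x)"]) auto
  then have "((\<lambda>t. h (x + t *\<^sub>R (y - x))) has_real_derivative D (y - x)) (at 0)"
    by (rule has_derivative_imp_has_field_derivative)
      (simp add: linear_scale[OF has_derivative_linear[OF der]])
  then have lim: "((\<lambda>t. (h (x + t *\<^sub>R (y - x)) - h x) / t) \<longlongrightarrow> D (y - x)) (at_right 0)"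
    unfolding has_field_derivative_iff by (simp add: filterlim_at_split)
  have "((\<lambda>t. h y - h x - \<alpha> / 2 * (1 - t) * (norm (y - x))\<^sup>2)
      \<longlongrightarrow> h y - h x - \<alpha> / 2 * (1 - 0) * (norm (y - x))\<^sup>2) (at_right 0)"
    by (intro tendsto_intros)
  then have "D (y - x) \<le> h y - h x - \<alpha> / 2 * (1 - 0) * (norm (y - x))\<^sup>2"
  proof (rule tendsto_le[OF trivial_limit_at_right_real _ lim])
    have "(h (x + t *\<^sub>R (y - x)) - h x) / t \<le> h y - h x - \<alpha> / 2 * (1 - t) * (norm (y - x))\<^sup>2"
      if "0 < t" "t < 1" for t
    proof -
      have "x + t *\<^sub>R (y - x) = t *\<^sub>R y + (1 - t) *\<^sub>R x" by (simp add: algebra_simps)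
      then have "h (x + t *\<^sub>R (y - x)) - h x \<le> t * (h y - h x - \<alpha> / 2 * (1 - t) * (norm (y - x))\<^sup>2)"
        using conv[of t y x] that by (simp add: algebra_simps)
      then show ?thesis using that by (simp add: pos_divide_le_eq mult.commute)
    qed
    then show "\<forall>\<^sub>F t in at_right 0. (h (x + t *\<^sub>R (y - x)) - h x) / t
        \<le> h y - h x - \<alpha> / 2 * (1 - t) * (norm (y - x))\<^sup>2"
      unfolding eventually_at_right_field by (intro exI[of _ 1]) auto
  qed
  then show ?thesis by simp
qed

text \<open>Dividing the inequality at \<open>x + t *\<^sub>R b\<close> by \<open>t^2\<close> and
  letting \<open>t\<close> decrease to 0. With \<open>h\<close> a gradient, this is the lower bound
  on the Hessian that lets the implicit function theorem apply.\<close>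

lemma strongly_monotone_derivative:
  fixes h :: "'a::euclidean_space \<Rightarrow> 'a"
  assumes mono: "\<And>y. \<alpha> * (norm (y - x))\<^sup>2 \<le> (h y - h x) \<bullet> (y - x)"
    and der: "(h has_derivative D) (at x)"
  shows "\<alpha> * (norm b)\<^sup>2 \<le> D b \<bullet> b"
proof -
  have "((\<lambda>t. x + t *\<^sub>R b) has_derivative (\<lambda>t. t *\<^sub>R b)) (at 0)"
    by (auto intro!: derivative_eq_intros)
  then have "((\<lambda>t. h (x + t *\<^sub>R b) \<bullet> b) has_derivative (\<lambda>t. D (t *\<^sub>R b) \<bullet> b)) (at 0)"
    using der by (intro has_derivative_inner_left
        has_derivative_compose[where g=h and f="\<lambda>t. x + t *\<^sub>R b"]) auto
  then have "((\<lambda>t. h (x + t *\<^sub>R b) \<bullet> b) has_real_derivative D b \<bullet> b) (at 0)"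
    by (rule has_derivative_imp_has_field_derivative)
      (simp add: linear_scale[OF has_derivative_linear[OF der]])
  then have lim: "((\<lambda>t. (h (x + t *\<^sub>R b) \<bullet> b - h x \<bullet> b) / t) \<longlongrightarrow> D b \<bullet> b) (at_right 0)"
    unfolding has_field_derivative_iff by (simp add: filterlim_at_split)
  have "\<alpha> * (norm b)\<^sup>2 \<le> (h (x + t *\<^sub>R b) \<bullet> b - h x \<bullet> b) / t" if "0 < t" for t
  proof -
    have "t * (t * (\<alpha> * (norm b)\<^sup>2)) \<le> t * ((h (x + t *\<^sub>R b) - h x) \<bullet> b)"
      using mono[of "x + t *\<^sub>R b"] by (simp add: power_mult_distrib power2_eq_square mult.assoc mult.left_commute)
    then show ?thesis
      using that by (simp add: pos_le_divide_eq inner_diff_left mult.commute)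
  qed
  then have "\<forall>\<^sub>F t in at_right 0. \<alpha> * (norm b)\<^sup>2 \<le> (h (x + t *\<^sub>R b) \<bullet> b - h x \<bullet> b) / t"
    unfolding eventually_at_right_field by (intro exI[of _ 1]) auto
  then show ?thesis
    by (intro tendsto_lowerbound[OF lim]) auto
qed

text \<open>The transposed Jacobian matrix applied to \<open>w\<close>. It has two readings: the
  gradient of the scalarisation \<open>w \<bullet> g\<close>, and a linear combination of the rows
  of \<open>jac g x\<close>, whose vanishing is a linear relation.\<close>

definition wgrad :: "(real ^ 'm \<Rightarrow> real ^ 'l) \<Rightarrow> real ^ 'l \<Rightarrow> real ^ 'm \<Rightarrow> real ^ 'm" where
  "wgrad g w x = (\<Sum>i\<in>UNIV. w $ i *\<^sub>R jac g x $ i)"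

lemma wgrad_inner: "wgrad g w x \<bullet> v = w \<bullet> (jac g x *v v)"
  by (simp add: wgrad_def inner_sum_left inner_vec_def[of w] matrix_vector_mul_component)

lemma linear_wgrad: "linear (\<lambda>w. wgrad g w x)"
  unfolding wgrad_def by (intro linearI) (auto simp: algebra_simps sum.distrib scaleR_sum_right)

lemma wgrad_axis: "wgrad g (axis i 1) x = jac g x $ i"
proof -
  have "wgrad g (axis i 1) x = (\<Sum>j\<in>UNIV. if j = i then jac g x $ j else 0)"
    unfolding wgrad_def by (intro sum.cong) (auto simp: axis_def)
  then show ?thesis by simp
qed

text \<open>Here \<open>p\<close> stands for \<open>r - 1\<close>: for \<open>g\<close> of class
  \<open>C^r\<close> both \<open>g\<close> and \<open>jac g\<close> have class \<open>C^p\<close>.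
  Strong convexity enters only through its gradient inequality, with one modulus for all
  components.\<close>

locale smooth_strongly_convex =
  fixes g :: "real ^ 'm \<Rightarrow> real ^ 'l" and p :: enat and \<alpha> :: real
  assumes p: "1 \<le> p" and smooth: "Cp_open p UNIV g" and smooth_jac: "Cp_open p UNIV (jac g)"
    and \<alpha>: "0 < \<alpha>"
    and gradient_ineq:
      "\<And>x y i. g x $ i + jac g x $ i \<bullet> (y - x) + \<alpha> / 2 * (norm (y - x))\<^sup>2 \<le> g y $ i"
begin

abbreviation "\<Delta> \<equiv> simplex_face (UNIV :: 'l set)"

lemma differentiable: "g differentiable (at x)"
proof -
  have "Ck_open (Suc 0) UNIV g"
    using smooth p unfolding Cp_open_def one_enat_def One_nat_def by blast
  then show ?thesis by simp
qed

lemma continuous_g: "continuous_on S g"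
  using differentiable by (intro differentiable_imp_continuous_on_set)

lemma weighted_ineq:
  assumes "w \<in> \<Delta>"
  shows "w \<bullet> g x + wgrad g w x \<bullet> (y - x) + \<alpha> / 2 * (norm (y - x))\<^sup>2 \<le> w \<bullet> g y"
proof -
  have "(\<Sum>i\<in>UNIV. w $ i * (g x $ i + jac g x $ i \<bullet> (y - x) + \<alpha> / 2 * (norm (y - x))\<^sup>2))
      \<le> (\<Sum>i\<in>UNIV. w $ i * g y $ i)"
    using assms gradient_ineq by (intro sum_mono mult_left_mono) (auto simp: simplex_face_def)
  moreover have "(\<Sum>i\<in>UNIV. w $ i * (g x $ i + jac g x $ i \<bullet> (y - x) + \<alpha> / 2 * (norm (y - x))\<^sup>2))
      = w \<bullet> g x + wgrad g w x \<bullet> (y - x) + (\<Sum>i\<in>UNIV. w $ i) * (\<alpha> / 2 * (norm (y - x))\<^sup>2)"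
    by (simp add: inner_vec_def[of w] wgrad_def inner_sum_left distrib_left sum.distrib sum_distrib_right)
  ultimately show ?thesis
    using assms by (simp add: simplex_face_def inner_vec_def[of w])
qed

text \<open>Sum of \<open>weighted_ineq\<close> for \<open>(x, y)\<close> and for
  \<open>(y, x)\<close>; the function values cancel and the two halves of \<open>\<alpha>\<close>
  add up.\<close>

lemma wgrad_strongly_monotone:
  assumes "w \<in> \<Delta>"
  shows "\<alpha> * (norm (y - x))\<^sup>2 \<le> (wgrad g w y - wgrad g w x) \<bullet> (y - x)"
proof -
  have "x - y = - (y - x)" by simp
  then have "wgrad g w y \<bullet> (x - y) = - (wgrad g w y \<bullet> (y - x))" by (metis inner_minus_right)
  then show ?thesis
    using weighted_ineq[OF assms, of x y] weighted_ineq[OF assms, of y x]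
    by (simp add: inner_diff_left norm_minus_commute[of x y])
qed

lemma wgrad_zero_unique:
  assumes "w \<in> \<Delta>" "wgrad g w x = 0" "wgrad g w y = 0"
  shows "x = y"
  using wgrad_strongly_monotone[OF assms(1), of y x] assms(2,3) \<alpha>
  by (simp add: mult_le_0_iff)

lemma wgrad_zero_exists:
  assumes "w \<in> \<Delta>"
  shows "\<exists>x. wgrad g w x = 0"
proof -
  let ?h = "\<lambda>x. w \<bullet> g x"
  \<comment> \<open>Beyond this radius the quadratic term of \<open>weighted_ineq\<close> at 0
    outweighs the linear one, so the value at 0 is not undercut and a minimum over the ball is
    global.\<close>
  define R where "R = 2 * norm (wgrad g w 0) / \<alpha>"
  have "R \<ge> 0" using \<alpha> by (simp add: R_def)
  have "continuous_on (cball 0 R) ?h"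
    using continuous_g by (intro continuous_intros)
  then obtain x where x: "x \<in> cball 0 R" "\<And>y. y \<in> cball 0 R \<Longrightarrow> ?h x \<le> ?h y"
    using continuous_attains_inf[of "cball 0 R" ?h] \<open>R \<ge> 0\<close> by auto
  have min: "?h x \<le> ?h y" for y
  proof (cases "y \<in> cball 0 R")
    case False
    then have "2 * norm (wgrad g w 0) / \<alpha> < norm y" by (simp add: R_def)
    then have "norm (wgrad g w 0) \<le> \<alpha> / 2 * norm y"
      using \<alpha> by (simp add: pos_divide_less_eq mult.commute)
    then have "norm (wgrad g w 0) * norm y \<le> \<alpha> / 2 * norm y * norm y"
      by (intro mult_right_mono) auto
    then have "0 \<le> wgrad g w 0 \<bullet> y + \<alpha> / 2 * (norm y)\<^sup>2"
      using Cauchy_Schwarz_ineq2[of "wgrad g w 0" y] by (simp add: power2_eq_square)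
    then have "?h 0 \<le> ?h y" using weighted_ineq[OF assms, of 0 y] by simp
    then show ?thesis using x(2)[of 0] \<open>R \<ge> 0\<close> by simp
  qed (use x in auto)
  have "(?h has_derivative (\<lambda>v. w \<bullet> (jac g x *v v))) (at x)"
    by (intro has_derivative_inner_right has_derivative_jac differentiable)
  then have "(\<lambda>v. w \<bullet> (jac g x *v v)) = (\<lambda>v. 0)"
    using min by (intro differential_zero_maxmin[of x UNIV ?h]) auto
  then have "wgrad g w x \<bullet> wgrad g w x = 0"
    unfolding wgrad_inner by (rule fun_cong)
  then show ?thesis by auto
qed

definition \<Phi> :: "real ^ 'l \<Rightarrow> real ^ 'm" where
  "\<Phi> w = (THE x. wgrad g w x = 0)"

lemma wgrad_\<Phi>: "w \<in> \<Delta> \<Longrightarrow> wgrad g w (\<Phi> w) = 0"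
  unfolding \<Phi>_def by (rule theI') (use wgrad_zero_exists wgrad_zero_unique in blast)

lemma \<Phi>_eqI: "w \<in> \<Delta> \<Longrightarrow> wgrad g w x = 0 \<Longrightarrow> \<Phi> w = x"
  using wgrad_\<Phi> wgrad_zero_unique by blast

text \<open>Some weights inside \<open>I\<close> may vanish, and then minimising a scalarisation
  only guarantees weak optimality in general. Strong convexity closes the gap: a dominating point
  would be a second minimiser.\<close>

lemma \<Phi>_pareto:
  assumes "w \<in> simplex_face I"
  shows "\<Phi> w \<in> pareto_set UNIV g I"
proof -
  have w: "w \<in> \<Delta>" using assms simplex_face_mono by blast
  have False if y: "\<forall>i\<in>I. g y $ i \<le> g (\<Phi> w) $ i" and j: "j \<in> I" "g y $ j < g (\<Phi> w) $ j" for y j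
  proof -
    have "w \<bullet> g y \<le> w \<bullet> g (\<Phi> w)"
      unfolding inner_vec_def inner_real_def
    proof (rule sum_mono)
      fix i
      show "w $ i * g y $ i \<le> w $ i * g (\<Phi> w) $ i"
        using y assms by (cases "i \<in> I") (auto simp: simplex_face_def intro: mult_left_mono)
    qed
    then have "\<alpha> / 2 * (norm (y - \<Phi> w))\<^sup>2 \<le> 0"
      using weighted_ineq[OF w, of "\<Phi> w" y] wgrad_\<Phi>[OF w] by simp
    then have "y = \<Phi> w" using \<alpha> by (simp add: mult_le_0_iff)
    then show False using j(2) by simp
  qed
  then show ?thesis unfolding pareto_set_def by blast
qed

text \<open>
  If no convex combination of the gradients at \<open>x\<close> vanishes, then a separating hyperplane gives a
  direction in which all components decrease.
\<close>

lemma pareto_wgrad_zero: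
  assumes "x \<in> pareto_set UNIV g I" "I \<noteq> {}"
  shows "\<exists>w\<in>simplex_face I. wgrad g w x = 0"
proof (rule ccontr)
  assume contr: "\<not> ?thesis"
  let ?S = "(\<lambda>w. wgrad g w x) ` simplex_face I"
  have "convex ?S"
    using convex_linear_image[OF linear_wgrad convex_simplex_face] .
  moreover have "compact ?S"
    using linear_wgrad compact_simplex_face
    by (intro compact_continuous_image linear_continuous_on) (auto simp: linear_conv_bounded_linear)
  then have "closed ?S" by (rule compact_imp_closed)
  moreover have "0 \<notin> ?S" using contr by force
  ultimately obtain a b where ab: "0 < b" "\<And>z. z \<in> ?S \<Longrightarrow> b < a \<bullet> z"
    using separating_hyperplane_closed_0 by metis
  have pos: "jac g x $ i \<bullet> a > 0" if "i \<in> I" for i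
  proof -
    have "b < a \<bullet> wgrad g (axis i 1) x"
      using axis_in_simplex_face[OF that] by (intro ab(2)) blast
    then show ?thesis using ab(1) by (simp add: wgrad_axis inner_commute)
  qed
  have "\<forall>\<^sub>F t in at_right 0. g (x + t *\<^sub>R (- a)) $ i < g x $ i" if "i \<in> I" for i
  proof -
    have "((\<lambda>t. x + t *\<^sub>R (- a)) has_derivative (\<lambda>t. t *\<^sub>R (- a))) (at 0)"
      by (auto intro!: derivative_eq_intros)
    then have "((\<lambda>t. g (x + t *\<^sub>R (- a)) $ i) has_derivative (\<lambda>t. jac g x $ i \<bullet> (t *\<^sub>R (- a)))) (at 0)"
      using has_derivative_jac_nth[OF differentiable, of i x]
      by (intro has_derivative_compose[where g="\<lambda>x. g x $ i" and f="\<lambda>t. x + t *\<^sub>R (- a)"]) auto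
    then have "((\<lambda>t. g (x + t *\<^sub>R (- a)) $ i) has_real_derivative - (jac g x $ i \<bullet> a)) (at 0)"
      by (rule has_derivative_imp_has_field_derivative) simp
    then obtain d where d: "d > 0" "\<And>h. 0 < h \<Longrightarrow> h < d \<Longrightarrow> g (x + (0 + h) *\<^sub>R (- a)) $ i < g (x + 0 *\<^sub>R (- a)) $ i"
      using DERIV_neg_dec_right[of "\<lambda>t. g (x + t *\<^sub>R (- a)) $ i"] pos[OF \<open>i \<in> I\<close>] by force
    then show ?thesis
      unfolding eventually_at_right_field by auto
  qed
  then have "\<forall>\<^sub>F t in at_right 0. \<forall>i\<in>I. g (x + t *\<^sub>R (- a)) $ i < g x $ i"
    by (intro eventually_ball_finite) auto
  then obtain t where "\<forall>i\<in>I. g (x + t *\<^sub>R (- a)) $ i < g x $ i"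
    using eventually_happens'[OF trivial_limit_at_right_real] by blast
  then show False
    using assms unfolding pareto_set_def by (auto intro: less_imp_le)
qed

lemma \<Phi>_image: "I \<noteq> {} \<Longrightarrow> \<Phi> ` simplex_face I = pareto_set UNIV g I"
proof (intro equalityI subsetI)
  fix x assume "I \<noteq> {}" "x \<in> pareto_set UNIV g I"
  then obtain w where "w \<in> simplex_face I" "wgrad g w x = 0" using pareto_wgrad_zero by blast
  moreover from this have "\<Phi> w = x" using \<Phi>_eqI simplex_face_mono by blast
  ultimately show "x \<in> \<Phi> ` simplex_face I" by blast
qed (use \<Phi>_pareto in blast)

section \<open>Smooth dependence of the minimiser on the weights\<close>

lemma smooth_wgrad: "Cp_open p UNIV (\<lambda>z. wgrad g (fst z) (snd z))"
  unfolding Cp_open_def wgrad_def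
proof (intro allI impI Ck_open_sum Ck_open_scaleR open_UNIV)
  fix k i assume "enat k \<le> p"
  show "Ck_open k UNIV (\<lambda>z :: (real ^ 'l) \<times> (real ^ 'm). fst z $ i)"
    by (intro Ck_open_nth Ck_open_bounded_linear bounded_linear_fst open_UNIV)
  show "Ck_open k UNIV (\<lambda>z :: (real ^ 'l) \<times> (real ^ 'm). jac g (snd z) $ i)"
    using smooth_jac \<open>enat k \<le> p\<close> unfolding Cp_open_def
    by (intro Ck_open_compose_bounded_linear[OF _ bounded_linear_vec_nth] open_UNIV
        Ck_open_compose[where f="jac g" and g=snd and U=UNIV and V=UNIV]
        Ck_open_bounded_linear[OF _ bounded_linear_snd]) auto
qed

text \<open>The map \<open>\<phi>\<close> extends \<open>\<Phi>\<close> to a neighbourhood of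
  \<open>w0\<close>. \<open>H\<close> is the Hessian of \<open>w0 \<bullet> g\<close> at
  \<open>\<Phi> w0\<close>; its lower bound gives the injectivity needed for the implicit function
  theorem. The last conclusion is the differentiated optimality condition.\<close>

lemma \<Phi>_local:
  assumes "w0 \<in> \<Delta>"
  obtains W \<phi> A H where "open W" "w0 \<in> W" "Cp_open p W \<phi>" "\<And>w. w \<in> W \<inter> \<Delta> \<Longrightarrow> \<phi> w = \<Phi> w"
    "(\<phi> has_derivative A) (at w0)" "linear H" "\<And>b. \<alpha> * (norm b)\<^sup>2 \<le> H b \<bullet> b"
    "\<And>v. wgrad g v (\<Phi> w0) + H (A v) = 0"
proof -
  let ?F = "\<lambda>z. wgrad g (fst z) (snd z)" and ?x0 = "\<Phi> w0"
  define D where "D = frechet_derivative ?F (at (w0, ?x0))"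
  define H where "H b = D (0, b)" for b
  have "Ck_open (Suc 0) UNIV ?F"
    using smooth_wgrad p unfolding Cp_open_def one_enat_def One_nat_def by blast
  then have der: "(?F has_derivative D) (at (w0, ?x0))"
    unfolding D_def using Ck_open_derivative by blast
  have derx: "((\<lambda>x. wgrad g w0 x) has_derivative H) (at ?x0)"
    using has_derivative_compose[where g="?F" and f="\<lambda>x. (w0, x)",
        OF has_derivative_Pair[OF has_derivative_const has_derivative_ident] der]
    unfolding H_def[abs_def] by simp
  have derw: "((\<lambda>w. wgrad g w ?x0) has_derivative (\<lambda>v. D (v, 0))) (at w0)"
    using has_derivative_compose[where g="?F" and f="\<lambda>w. (w, ?x0)",
        OF has_derivative_Pair[OF has_derivative_ident has_derivative_const] der]
    by simp
  have "((\<lambda>w. wgrad g w ?x0) has_derivative (\<lambda>w. wgrad g w ?x0)) (at w0)"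
    by (rule linear_imp_has_derivative[OF linear_wgrad])
  \<comment> \<open>\<open>wgrad\<close> is linear in the weights, so it is its own partial
    derivative there.\<close>
  then have Dw: "D (v, 0) = wgrad g v ?x0" for v
    using has_derivative_unique[OF derw] by metis
  have H: "\<alpha> * (norm b)\<^sup>2 \<le> H b \<bullet> b" for b
    using strongly_monotone_derivative[OF wgrad_strongly_monotone[OF assms] derx] .
  have inj: "b = 0" if "frechet_derivative ?F (at (w0, ?x0)) (0, b) = 0" for b
    using H[of b] that \<alpha> by (simp add: H_def D_def mult_le_0_iff)
  have zero: "?F (w0, ?x0) = 0" using wgrad_\<Phi>[OF assms] by simp
  obtain W \<phi> where W: "open W" "w0 \<in> W" "\<phi> w0 = ?x0" "Cp_open p W \<phi>"
    "\<And>w. w \<in> W \<Longrightarrow> (w, \<phi> w) \<in> UNIV \<and> ?F (w, \<phi> w) = 0"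
    using implicit_function[OF open_UNIV smooth_wgrad p UNIV_I zero inj] by metis
  \<comment> \<open>Zeros are unique globally for weights in the simplex, so the two maps agree on
    all of \<open>W \<inter> \<Delta>\<close> without shrinking \<open>W\<close>.\<close>
  have \<phi>: "\<phi> w = \<Phi> w" if "w \<in> W \<inter> \<Delta>" for w
    using W(5)[of w] \<Phi>_eqI[of w "\<phi> w"] that by simp
  have "Ck_open (Suc 0) W \<phi>"
    using W(4) p unfolding Cp_open_def one_enat_def One_nat_def by blast
  then obtain A where A: "(\<phi> has_derivative A) (at w0)"
    using Ck_open_derivative W(2) by blast
  have "wgrad g v ?x0 + H (A v) = 0" for v
  proof -
    have "((\<lambda>w. (w, \<phi> w)) has_derivative (\<lambda>v. (v, A v))) (at w0)"
      by (intro has_derivative_Pair has_derivative_ident A)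
    then have "((\<lambda>w. ?F (w, \<phi> w)) has_derivative (\<lambda>v. D (v, A v))) (at w0)"
      using der W(3) by (intro has_derivative_compose[where g="?F" and f="\<lambda>w. (w, \<phi> w)"]) auto
    moreover have "((\<lambda>w. ?F (w, \<phi> w)) has_derivative (\<lambda>v. 0)) (at w0)"
      by (rule has_derivative_transform_within_open[OF has_derivative_const W(1,2)])
        (use W(5) in auto)
    ultimately have "(\<lambda>v. D (v, A v)) = (\<lambda>v. 0)" by (rule has_derivative_unique)
    then have "D (v, A v) = 0" by (rule fun_cong)
    then show ?thesis
      using linear_add[OF has_derivative_linear[OF der], of "(v, 0)" "(0, A v)"]
      by (simp add: Dw H_def)
  qed
  with W \<phi> A has_derivative_linear[OF derx] H that show thesis by blast
qed

lemma continuous_\<Phi>: "continuous_on \<Delta> \<Phi>"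
  unfolding continuous_on_eq_continuous_within
proof
  fix w0 assume w0: "w0 \<in> \<Delta>"
  obtain W \<phi> A H where W: "open W" "w0 \<in> W" "\<And>w. w \<in> W \<inter> \<Delta> \<Longrightarrow> \<phi> w = \<Phi> w"
    "(\<phi> has_derivative A) (at w0)"
    using \<Phi>_local[OF w0] by metis
  have "continuous (at w0 within \<Delta>) \<phi>"
    using has_derivative_continuous[OF W(4)] continuous_at_imp_continuous_at_within by blast
  moreover have "\<forall>\<^sub>F w in at w0 within \<Delta>. \<phi> w = \<Phi> w"
    unfolding eventually_at_topological using W(1-3) by blast
  moreover have "\<phi> w0 = \<Phi> w0" using W(2,3) w0 by blast
  ultimately show "continuous (at w0 within \<Delta>) \<Phi>"
    unfolding continuous_within by (simp add: tendsto_cong)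
qed

text \<open>A Pareto point \<open>x\<close> is the unique minimiser of some scalarisation
  \<open>w \<bullet> g\<close>, and a point with the same image has the same value of
  \<open>w \<bullet> g\<close>.\<close>

lemma inj_g_pareto:
  assumes "I \<noteq> {}"
  shows "inj_on g (pareto_set UNIV g I)"
proof (rule inj_onI)
  fix x y assume x: "x \<in> pareto_set UNIV g I" and eq: "g x = g y"
  then obtain w where w: "w \<in> simplex_face I" "wgrad g w x = 0"
    using pareto_wgrad_zero[OF x assms] by blast
  then have "\<alpha> / 2 * (norm (y - x))\<^sup>2 \<le> 0"
    using weighted_ineq[of w x y] eq simplex_face_mono[of I UNIV] by auto
  then show "x = y" using \<alpha> by (simp add: mult_le_0_iff)
qed

lemma simplicial:
  assumes nondeg: "\<And>x w u. w \<in> \<Delta> \<Longrightarrow> wgrad g w x = 0 \<Longrightarrow> wgrad g u x = 0 \<Longrightarrow>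
      (\<Sum>i\<in>UNIV. u $ i) = 0 \<Longrightarrow> u = 0"
    and card: "CARD('l) \<le> CARD('m)"
  shows "simplicial_problem p UNIV g"
proof -
  have sub: "simplex_face I \<subseteq> \<Delta>" for I using simplex_face_mono by blast
  have inj: "inj_on \<Phi> \<Delta>"
  proof (rule inj_onI)
    fix w w' assume w: "w \<in> \<Delta>" "w' \<in> \<Delta>" "\<Phi> w = \<Phi> w'"
    \<comment> \<open>Two weights with the same minimiser differ by a zero-sum relation between the
      rows, which \<open>nondeg\<close> excludes unless it is trivial.\<close>
    have "wgrad g (w' - w) (\<Phi> w) = 0"
      using wgrad_\<Phi>[OF w(1)] wgrad_\<Phi>[OF w(2)] w(3) by (simp add: linear_diff[OF linear_wgrad])
    moreover have "(\<Sum>i\<in>UNIV. (w' - w) $ i) = 0"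
      using w by (simp add: simplex_face_def sum_subtractf)
    ultimately have "w' - w = 0" by (rule nondeg[OF w(1) wgrad_\<Phi>[OF w(1)]])
    then show "w = w'" by simp
  qed
  have imm: "face_immersion p I \<Phi> \<and> face_immersion p I (g \<circ> \<Phi>)" for I
  proof -
    have *: "\<exists>W \<phi> A. open W \<and> w0 \<in> W \<and> Cp_open p W \<phi> \<and> (\<forall>w\<in>W \<inter> simplex_face I. \<phi> w = \<Phi> w) \<and>
        (\<phi> has_derivative A) (at w0) \<and>
        (\<forall>v. (\<Sum>i\<in>UNIV. v $ i) = 0 \<longrightarrow> jac g (\<Phi> w0) *v A v = 0 \<longrightarrow> v = 0)"
      if "w0 \<in> simplex_face I" for w0
    proof -
      have w0: "w0 \<in> \<Delta>" using that sub by blast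
      obtain W \<phi> A H where W: "open W" "w0 \<in> W" "Cp_open p W \<phi>" "\<And>w. w \<in> W \<inter> \<Delta> \<Longrightarrow> \<phi> w = \<Phi> w"
        "(\<phi> has_derivative A) (at w0)" "linear H" "\<And>b. \<alpha> * (norm b)\<^sup>2 \<le> H b \<bullet> b"
        "\<And>v. wgrad g v (\<Phi> w0) + H (A v) = 0"
        using \<Phi>_local[OF w0] by metis
      have "v = 0" if v: "(\<Sum>i\<in>UNIV. v $ i) = 0" "jac g (\<Phi> w0) *v A v = 0" for v
      proof -
        \<comment> \<open>Pairing with \<open>A v\<close> turns the first term into
          \<open>v \<bullet> (jac g (\<Phi> w0) *v A v)\<close>, which vanishes by assumption.
          Positivity of \<open>H\<close> then gives \<open>A v = 0\<close>, the identity itself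
          gives \<open>wgrad g v (\<Phi> w0) = 0\<close>, and \<open>nondeg\<close>
          finishes.\<close>
        have "(wgrad g v (\<Phi> w0) + H (A v)) \<bullet> A v = 0" using W(8) by simp
        then have "H (A v) \<bullet> A v = 0"
          using v(2) by (simp add: inner_add_left wgrad_inner)
        then have "A v = 0" using W(7)[of "A v"] \<alpha> by (simp add: mult_le_0_iff)
        then have "wgrad g v (\<Phi> w0) = 0"
          using W(8)[of v] linear_0[OF W(6)] by simp
        then show "v = 0" using nondeg[OF w0 wgrad_\<Phi>[OF w0]] v(1) by blast
      qed
      with W sub show ?thesis by blast
    qed
    have eq: "\<phi> w0 = \<Phi> w0" if "w0 \<in> simplex_face I" "w0 \<in> W" "\<forall>w\<in>W \<inter> simplex_face I. \<phi> w = \<Phi> w" for W \<phi> w0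
      using that by blast
    have "Cp_on p (simplex_face I) \<Phi>"
      unfolding Cp_on_def using * by blast
    moreover have "Cp_on p (simplex_face I) (g \<circ> \<Phi>)"
      unfolding Cp_on_def
    proof
      fix w0 assume "w0 \<in> simplex_face I"
      then obtain W \<phi> where W: "open W" "w0 \<in> W" "Cp_open p W \<phi>" "\<forall>w\<in>W \<inter> simplex_face I. \<phi> w = \<Phi> w"
        using * by blast
      then have "Cp_open p W (\<lambda>w. g (\<phi> w))"
        using smooth by (intro Cp_open_compose[where f=g and g=\<phi> and V=UNIV]) auto
      with W show "\<exists>U ga. open U \<and> w0 \<in> U \<and> Cp_open p U ga \<and> (\<forall>y\<in>U \<inter> simplex_face I. ga y = (g \<circ> \<Phi>) y)"
        by (intro exI[of _ W] exI[of _ "\<lambda>w. g (\<phi> w)"]) auto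
    qed
    moreover have "\<exists>D. (\<Phi> has_derivative D) (at w0 within simplex_face I) \<and>
          ((g \<circ> \<Phi>) has_derivative (\<lambda>v. jac g (\<Phi> w0) *v D v)) (at w0 within simplex_face I) \<and>
          (\<forall>v. (\<Sum>i\<in>UNIV. v $ i) = 0 \<longrightarrow> jac g (\<Phi> w0) *v D v = 0 \<longrightarrow> v = 0)"
      if w0: "w0 \<in> simplex_face I" for w0
    proof -
      obtain W \<phi> A where W: "open W" "w0 \<in> W" "\<forall>w\<in>W \<inter> simplex_face I. \<phi> w = \<Phi> w"
        "(\<phi> has_derivative A) (at w0)"
        "\<forall>v. (\<Sum>i\<in>UNIV. v $ i) = 0 \<longrightarrow> jac g (\<Phi> w0) *v A v = 0 \<longrightarrow> v = 0"
        using *[OF w0] by blast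
      obtain e where e: "e > 0" "ball w0 e \<subseteq> W" using W(1,2) open_contains_ball by blast
      have 1: "(\<Phi> has_derivative A) (at w0 within simplex_face I)"
        by (rule has_derivative_transform_within[OF has_derivative_at_withinI[OF W(4)] e(1) w0])
          (use W(3) e(2) in \<open>auto simp: dist_commute subset_iff\<close>)
      have "((\<lambda>w. g (\<Phi> w)) has_derivative (\<lambda>v. jac g (\<Phi> w0) *v A v)) (at w0 within simplex_face I)"
        by (rule has_derivative_compose[where g=g and f=\<Phi>, OF 1 has_derivative_jac[OF differentiable]])
      with 1 W(5) show ?thesis unfolding comp_def by blast
    qed
    \<comment> \<open>If the derivative of \<open>\<Phi>\<close> kills \<open>v\<close>, so does
      that of \<open>g \<circ> \<Phi>\<close>; hence the injectivity proved for the composition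
      covers both maps.\<close>
    moreover have "jac g (\<Phi> w0) *v 0 = 0" for w0 by simp
    ultimately show ?thesis
      unfolding face_immersion_def by metis
  qed
  \<comment> \<open>The hypothesis \<open>card\<close> leaves room in \<open>real ^ 'm\<close> for
    model orthants of the dimension of each face.\<close>
  obtain \<sigma> :: "'l \<Rightarrow> 'm" where \<sigma>: "inj \<sigma>"
    using card_le_inj[OF finite finite, of "UNIV :: 'l set" "UNIV :: 'm set"] card by auto
  have hom: "\<exists>k. homeomorphism (simplex_face I) (pareto_set UNIV g I) \<Phi> k" if "I \<noteq> {}" for I
    using \<Phi>_image[OF that] continuous_on_subset[OF continuous_\<Phi> sub] inj_on_subset[OF inj sub]
    by (intro homeomorphism_compact compact_simplex_face)
  have "Cp_diffeomorphism p (simplex_face I) (pareto_set UNIV g I) \<Phi> \<and>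
      Cp_diffeomorphism p (pareto_set UNIV g I) (g ` pareto_set UNIV g I) g" if I: "I \<noteq> {}" for I
  proof -
    obtain k where k: "homeomorphism (simplex_face I) (pareto_set UNIV g I) \<Phi> k"
      using hom[OF I] by blast
    have "Cp_immersion p (simplex_face I) \<Phi>"
      using imm by (intro Cp_immersion_simplex[OF inj_on_id face_immersion_ident homeomorphism_ident])
        (simp add: comp_def)
    moreover have "Cp_immersion p (pareto_set UNIV g I) g"
      using imm by (intro Cp_immersion_simplex[OF \<sigma> _ k]) auto
    moreover have "compact (pareto_set UNIV g I)"
      using compact_continuous_image[OF continuous_on_subset[OF continuous_\<Phi> sub] compact_simplex_face]
        \<Phi>_image[OF I] by metis
    then have "\<exists>k. homeomorphism (pareto_set UNIV g I) (g ` pareto_set UNIV g I) g k"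
      using continuous_g inj_g_pareto[OF I] by (intro homeomorphism_compact) auto
    ultimately show ?thesis
      unfolding Cp_diffeomorphism_def using k by blast
  qed
  moreover have "Cp_map p \<Delta> (pareto_set UNIV g UNIV) \<Phi>"
    using p imm \<Phi>_image[of UNIV] by (intro Cp_map_simplex) (auto simp: one_eSuc)
  ultimately show ?thesis
    unfolding simplicial_problem_def by blast
qed

end

section \<open>Linear perturbations\<close>

text \<open>Each component has its own modulus; as there are finitely many, their minimum is
  positive and serves all of them.\<close>

lemma strongly_convex_mapping_gradient_ineq:
  fixes g :: "real ^ 'm \<Rightarrow> real ^ 'l"
  assumes conv: "strongly_convex_mapping UNIV g" and diff: "\<And>x. g differentiable (at x)"
  shows "\<exists>\<alpha>>0. \<forall>x y i. g x $ i + jac g x $ i \<bullet> (y - x) + \<alpha> / 2 * (norm (y - x))\<^sup>2 \<le> g y $ i"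
proof -
  have "\<exists>\<alpha>>0. \<forall>x y. g x $ i + jac g x $ i \<bullet> (y - x) + \<alpha> / 2 * (norm (y - x))\<^sup>2 \<le> g y $ i" for i
  proof -
    obtain \<alpha> where "\<alpha> > 0" and *: "\<And>x y t. t \<in> {0..1} \<Longrightarrow> g (t *\<^sub>R x + (1 - t) *\<^sub>R y) $ i
        \<le> t * g x $ i + (1 - t) * g y $ i - 1 / 2 * \<alpha> * t * (1 - t) * (norm (x - y))\<^sup>2"
      using conv unfolding strongly_convex_mapping_def strongly_convex_on_def by blast
    then show ?thesis
      using strongly_convex_gradient_ineq[where h="\<lambda>x. g x $ i", OF * has_derivative_jac_nth[OF diff]]
      by blast
  qed
  then obtain a where a: "\<And>i. a i > 0"
    "\<And>i x y. g x $ i + jac g x $ i \<bullet> (y - x) + a i / 2 * (norm (y - x))\<^sup>2 \<le> g y $ i"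
    by metis
  define \<alpha> where "\<alpha> = Min (range a)"
  have "\<alpha> \<in> range a" unfolding \<alpha>_def by (intro Min_in) auto
  then have "\<alpha> > 0" using a(1) by auto
  moreover have "g x $ i + jac g x $ i \<bullet> (y - x) + \<alpha> / 2 * (norm (y - x))\<^sup>2 \<le> g y $ i" for x y i
  proof -
    have "\<alpha> \<le> a i" unfolding \<alpha>_def by (intro Min_le) auto
    then have "\<alpha> / 2 * (norm (y - x))\<^sup>2 \<le> a i / 2 * (norm (y - x))\<^sup>2"
      by (intro mult_right_mono) auto
    then show ?thesis using a(2)[of x i y] by linarith
  qed
  ultimately show ?thesis by blast
qed

lemma strongly_convex_mapping_add_linear:
  fixes f :: "real ^ 'm \<Rightarrow> real ^ 'l"
  assumes "strongly_convex_mapping UNIV f"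
  shows "strongly_convex_mapping UNIV (\<lambda>x. f x + \<pi> *v x)"
  unfolding strongly_convex_mapping_def strongly_convex_on_def
proof (intro allI conjI convex_UNIV)
  fix i
  obtain \<alpha> where \<alpha>: "\<alpha> > 0" "\<And>x y t. t \<in> {0..1} \<Longrightarrow> f (t *\<^sub>R x + (1 - t) *\<^sub>R y) $ i
        \<le> t * f x $ i + (1 - t) * f y $ i - 1 / 2 * \<alpha> * t * (1 - t) * (norm (x - y))\<^sup>2"
    using assms unfolding strongly_convex_mapping_def strongly_convex_on_def by blast
  have lin: "\<pi> *v (t *\<^sub>R x + (1 - t) *\<^sub>R y) = t *\<^sub>R (\<pi> *v x) + (1 - t) *\<^sub>R (\<pi> *v y)" for t x y
    by (simp add: matrix_vector_right_distrib matrix_vector_mult_scaleR)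
  have "(f (t *\<^sub>R x + (1 - t) *\<^sub>R y) + \<pi> *v (t *\<^sub>R x + (1 - t) *\<^sub>R y)) $ i
      \<le> t * (f x + \<pi> *v x) $ i + (1 - t) * (f y + \<pi> *v y) $ i
        - 1 / 2 * \<alpha> * t * (1 - t) * (norm (x - y))\<^sup>2" if "t \<in> {0..1}" for x y t
    using \<alpha>(2)[OF that, of x y] unfolding lin by (simp add: distrib_left)
  with \<alpha>(1) show "\<exists>\<alpha>>0. \<forall>x\<in>UNIV. \<forall>y\<in>UNIV. \<forall>t\<in>{0..1}.
        (f (t *\<^sub>R x + (1 - t) *\<^sub>R y) + \<pi> *v (t *\<^sub>R x + (1 - t) *\<^sub>R y)) $ i
          \<le> t * (f x + \<pi> *v x) $ i + (1 - t) * (f y + \<pi> *v y) $ i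
            - 1 / 2 * \<alpha> * t * (1 - t) * (norm (x - y))\<^sup>2"
    by blast
qed

lemma Cp_open_add_linear:
  fixes f :: "real ^ 'm \<Rightarrow> real ^ 'l"
  assumes "Cp_open r UNIV f"
  shows "Cp_open r UNIV (\<lambda>x. f x + \<pi> *v x)"
proof -
  have "Ck_open k UNIV ((*v) \<pi>)" for k
    by (rule Ck_open_bounded_linear[OF open_UNIV matrix_vector_mul_bounded_linear])
  then show ?thesis
    using assms Ck_open_add[OF open_UNIV] unfolding Cp_open_def by blast
qed

lemma jac_add_linear:
  assumes "f differentiable (at x)"
  shows "jac (\<lambda>x. f x + \<pi> *v x) x = jac f x + \<pi>"
proof (rule jac_unique)
  have "((\<lambda>x. f x + \<pi> *v x) has_derivative (\<lambda>v. jac f x *v v + \<pi> *v v)) (at x)"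
    by (intro has_derivative_add has_derivative_jac assms
        bounded_linear_imp_has_derivative matrix_vector_mul_bounded_linear)
  then show "((\<lambda>x. f x + \<pi> *v x) has_derivative (*v) (jac f x + \<pi>)) (at x)"
    by (simp add: matrix_vector_mult_add_rdistrib[abs_def])
qed

section \<open>Matrices whose rows satisfy two independent relations\<close>

lemma solve_linear_relation:
  fixes B :: "'l::finite \<Rightarrow> 'v::real_vector"
  assumes "(\<Sum>k\<in>UNIV. a k *\<^sub>R B k) = 0" "a i \<noteq> 0" "a j = 0"
  shows "(\<Sum>k\<in>UNIV. (if k \<in> {i, j} then 0 else - (a k / a i)) *\<^sub>R (if k \<in> {i, j} then 0 else B k)) = B i"
proof -
  \<comment> \<open>At \<open>k = i\<close> the first summand is \<open>- B i\<close>, cancelled by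
    the added \<open>B i\<close>; at \<open>k = j\<close> it vanishes because
    \<open>a j = 0\<close>.\<close>
  have "(\<Sum>k\<in>UNIV. (if k \<in> {i, j} then 0 else - (a k / a i)) *\<^sub>R (if k \<in> {i, j} then 0 else B k))
      = (\<Sum>k\<in>UNIV. (- 1 / a i) *\<^sub>R (a k *\<^sub>R B k) + (if k = i then B i else 0))"
    using assms(2,3) by (intro sum.cong) auto
  also have "\<dots> = (- 1 / a i) *\<^sub>R (\<Sum>k\<in>UNIV. a k *\<^sub>R B k) + B i"
    unfolding sum.distrib scaleR_sum_right[symmetric] by simp
  finally show ?thesis using assms(1) by simp
qed

text \<open>
  Two independent relations between the rows of \<open>B\<close> express two rows \<open>i\<close>, \<open>j\<close> by the other ones,
  so \<open>B\<close> is determined by \<open>CARD('l) - 2\<close> rows and \<open>2 * (CARD('l) - 2)\<close> coefficients.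
\<close>

lemma two_relations:
  fixes B :: "'l::finite \<Rightarrow> 'v::real_vector" and w u :: "'l \<Rightarrow> real"
  assumes w: "(\<Sum>k\<in>UNIV. w k *\<^sub>R B k) = 0" "(\<Sum>k\<in>UNIV. w k) = 1"
    and u: "(\<Sum>k\<in>UNIV. u k *\<^sub>R B k) = 0" "(\<Sum>k\<in>UNIV. u k) = 0" "u \<noteq> (\<lambda>_. 0)"
  obtains i j c d where "i \<noteq> j" "\<And>k. k \<in> {i, j} \<Longrightarrow> c k = 0 \<and> d k = 0"
    "(\<Sum>k\<in>UNIV. c k *\<^sub>R (if k \<in> {i, j} then 0 else B k)) = B i"
    "(\<Sum>k\<in>UNIV. d k *\<^sub>R (if k \<in> {i, j} then 0 else B k)) = B j"
proof -
  obtain j where j: "u j \<noteq> 0" using u(3) by auto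
  \<comment> \<open>Elimination of coefficient \<open>j\<close> by means of \<open>u\<close>. Since
    \<open>u\<close> is zero-sum, \<open>w'\<close> still sums to 1 and so has a nonzero entry
    \<open>i\<close>.\<close>
  define w' where "w' k = w k - w j / u j * u k" for k
  have w': "(\<Sum>k\<in>UNIV. w' k *\<^sub>R B k) = 0" "(\<Sum>k\<in>UNIV. w' k) = 1" "w' j = 0"
  proof -
    have "(\<Sum>k\<in>UNIV. w' k *\<^sub>R B k) = (\<Sum>k\<in>UNIV. w k *\<^sub>R B k) - (w j / u j) *\<^sub>R (\<Sum>k\<in>UNIV. u k *\<^sub>R B k)"
      by (simp add: w'_def scaleR_diff_left sum_subtractf scaleR_sum_right)
    then show "(\<Sum>k\<in>UNIV. w' k *\<^sub>R B k) = 0" using w u by simp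
    show "(\<Sum>k\<in>UNIV. w' k) = 1"
      unfolding w'_def sum_subtractf sum_distrib_left[symmetric] using w(2) u(2) by simp
  qed (use j in \<open>simp add: w'_def\<close>)
  have "\<exists>i. w' i \<noteq> 0"
    using w'(2) by (metis sum.neutral zero_neq_one)
  then obtain i where i: "w' i \<noteq> 0" by blast
  then have ij: "i \<noteq> j" using w'(3) by blast
  \<comment> \<open>Elimination of coefficient \<open>i\<close>; because \<open>w' j = 0\<close>,
    entry \<open>j\<close> remains \<open>u j\<close> and is nonzero.\<close>
  define u' where "u' k = u k - u i / w' i * w' k" for k
  have "(\<Sum>k\<in>UNIV. u' k *\<^sub>R B k) = (\<Sum>k\<in>UNIV. u k *\<^sub>R B k) - (u i / w' i) *\<^sub>R (\<Sum>k\<in>UNIV. w' k *\<^sub>R B k)"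
    by (simp add: u'_def scaleR_diff_left sum_subtractf scaleR_sum_right)
  then have u': "(\<Sum>k\<in>UNIV. u' k *\<^sub>R B k) = 0" "u' i = 0" "u' j \<noteq> 0"
    using w'(1,3) u(1) i j by (simp_all add: u'_def)
  show thesis
    using that[OF ij _ solve_linear_relation[OF w'(1) i w'(3)]
        solve_linear_relation[OF u'(1,3,2), unfolded insert_commute[of j i]]]
    by simp
qed

text \<open>\<open>A\<close> supplies rows of the perturbed Jacobian matrix, with rows
  \<open>i\<close> and \<open>j\<close> recomputed from the coefficients \<open>c\<close> and
  \<open>d\<close>; subtracting the Jacobian matrix of \<open>f\<close> recovers
  \<open>\<pi>\<close>. All rows of \<open>A\<close> are kept so that the parameters fill a
  Euclidean space given by a type; the true dimension is imposed by a coordinate subspace.\<close>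

definition degenerate_param ::
  "(real ^ 'm \<Rightarrow> real ^ 'l) \<Rightarrow> 'l \<Rightarrow> 'l \<Rightarrow>
   (real ^ 'm) \<times> (real ^ 'm ^ 'l) \<times> (real ^ 'l) \<times> (real ^ 'l) \<Rightarrow> real ^ 'm ^ 'l" where
  "degenerate_param f i j = (\<lambda>(x, A, c, d). \<chi> k.
     (if k = i then \<Sum>l\<in>UNIV. c $ l *\<^sub>R A $ l
      else if k = j then \<Sum>l\<in>UNIV. d $ l *\<^sub>R A $ l else A $ k) + (- 1) *\<^sub>R jac f x $ k)"

text \<open>The free coordinates: all of \<open>x\<close>, and the entries of \<open>A\<close>,
  \<open>c\<close>, \<open>d\<close> with row index other than \<open>i\<close>, \<open>j\<close>.
  Their number is the parameter count of the overview.\<close>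

definition degenerate_directions ::
  "'l::finite \<Rightarrow> 'l \<Rightarrow> ((real ^ 'm) \<times> (real ^ 'm ^ 'l) \<times> (real ^ 'l) \<times> (real ^ 'l)) set" where
  "degenerate_directions i j =
     range (\<lambda>n. (axis n 1, 0, 0, 0)) \<union>
     (\<lambda>(k, n). (0, axis k (axis n 1), 0, 0)) ` ((- {i, j}) \<times> UNIV) \<union>
     (\<lambda>k. (0, 0, axis k 1, 0)) ` (- {i, j}) \<union>
     (\<lambda>k. (0, 0, 0, axis k 1)) ` (- {i, j})"

lemma Basis_param_cases:
  fixes b :: "(real ^ 'm) \<times> (real ^ 'm ^ 'l) \<times> (real ^ 'l) \<times> (real ^ 'l)"
  shows "b \<in> Basis \<longleftrightarrow> (\<exists>n. b = (axis n 1, 0, 0, 0)) \<or> (\<exists>k n. b = (0, axis k (axis n 1), 0, 0)) \<or>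
    (\<exists>k. b = (0, 0, axis k 1, 0)) \<or> (\<exists>k. b = (0, 0, 0, axis k 1))"
proof -
  have vec: "(Basis :: (real ^ 'm) set) = range (\<lambda>n. axis n 1)"
    "(Basis :: (real ^ 'l) set) = range (\<lambda>n. axis n 1)"
    by (auto simp: Basis_vec_def)
  have mat: "(Basis :: (real ^ 'm ^ 'l) set) = (\<Union>k. range (\<lambda>n. axis k (axis n 1)))"
    by (auto simp: Basis_vec_def)
  show ?thesis
    unfolding Basis_prod_def vec mat zero_prod_def by (auto simp: image_iff; blast)
qed

lemma degenerate_directions_Basis: "degenerate_directions i j \<subseteq> Basis"
proof
  fix b assume "b \<in> degenerate_directions i j"
  then show "b \<in> Basis"
    unfolding Basis_param_cases degenerate_directions_def by auto
qed

lemma card_degenerate_directions: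
  assumes "i \<noteq> (j :: 'l::finite)"
  shows "card (degenerate_directions i j :: ((real ^ 'm) \<times> (real ^ 'm ^ 'l) \<times> (real ^ 'l) \<times> (real ^ 'l)) set)
    \<le> CARD('m) + (CARD('l) - 2) * CARD('m) + 2 * (CARD('l) - 2)"
proof -
  have c: "card (- {i, j}) = CARD('l) - 2"
    using assms by (simp add: Compl_eq_Diff_UNIV card_Diff_subset)
  have "card (degenerate_directions i j :: ((real ^ 'm) \<times> (real ^ 'm ^ 'l) \<times> (real ^ 'l) \<times> (real ^ 'l)) set)
      \<le> CARD('m) + card ((- {i, j}) \<times> (UNIV :: 'm set)) + card (- {i, j}) + card (- {i, j})"
    unfolding degenerate_directions_def
    by (intro order_trans[OF card_Un_le] add_mono card_image_le) auto
  then show ?thesis by (simp add: c card_cartesian_product)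
qed

lemma degenerate_directions_orthogonal:
  fixes A :: "real ^ 'm ^ 'l"
  assumes "A $ i = 0" "A $ j = 0" "c $ i = 0" "c $ j = 0" "d $ i = 0" "d $ j = 0"
  shows "\<forall>b\<in>Basis - degenerate_directions i j. (x, A, c, d) \<bullet> b = 0"
proof
  fix b :: "(real ^ 'm) \<times> (real ^ 'm ^ 'l) \<times> (real ^ 'l) \<times> (real ^ 'l)"
  assume b: "b \<in> Basis - degenerate_directions i j"
  then consider n where "b = (axis n 1, 0, 0, 0)" | k n where "b = (0, axis k (axis n 1), 0, 0)"
    | k where "b = (0, 0, axis k 1, 0)" | k where "b = (0, 0, 0, axis k 1)"
    using Basis_param_cases[of b] by blast
  then show "(x, A, c, d) \<bullet> b = 0"
  proof cases
    case (1 n)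
    then show ?thesis using b by (simp add: degenerate_directions_def)
  next
    case (2 k n)
    then have "k \<in> {i, j}" using b by (auto simp: degenerate_directions_def)
    then have "A $ k = 0" using assms by blast
    then show ?thesis by (simp add: 2 inner_axis)
  next
    case (3 k)
    then have "k \<in> {i, j}" using b by (auto simp: degenerate_directions_def)
    then have "c $ k = 0" using assms by blast
    then show ?thesis by (simp add: 3 inner_axis)
  next
    case (4 k)
    then have "k \<in> {i, j}" using b by (auto simp: degenerate_directions_def)
    then have "d $ k = 0" using assms by blast
    then show ?thesis by (simp add: 4 inner_axis)
  qed
qed

text \<open>Apart from \<open>jac f\<close> the map is polynomial, so it is as smooth as
  \<open>jac f\<close>.\<close>

lemma Ck_open_degenerate_param:
  fixes f :: "real ^ 'm \<Rightarrow> real ^ 'l"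
  assumes "Ck_open k UNIV (jac f)"
  shows "Ck_open k UNIV (degenerate_param f i j)"
proof -
  let ?Z = "UNIV :: ((real ^ 'm) \<times> (real ^ 'm ^ 'l) \<times> (real ^ 'l) \<times> (real ^ 'l)) set"
  note comp = Ck_open_compose_bounded_linear[OF open_UNIV]
  note bl = bounded_linear_fst bounded_linear_snd bounded_linear_vec_nth bounded_linear_ident
  have A: "Ck_open k ?Z (\<lambda>z. fst (snd z) $ l)" for l
    by (intro Ck_open_bounded_linear open_UNIV bounded_linear_compose[OF bounded_linear_vec_nth]
        bounded_linear_compose[OF bounded_linear_fst] bl)
  have c: "Ck_open k ?Z (\<lambda>z. fst (snd (snd z)) $ l)" for l
    by (intro Ck_open_bounded_linear open_UNIV bounded_linear_compose[OF bounded_linear_vec_nth]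
        bounded_linear_compose[OF bounded_linear_fst] bounded_linear_compose[OF bounded_linear_snd] bl)
  have d: "Ck_open k ?Z (\<lambda>z. snd (snd (snd z)) $ l)" for l
    by (intro Ck_open_bounded_linear open_UNIV bounded_linear_compose[OF bounded_linear_vec_nth]
        bounded_linear_compose[OF bounded_linear_snd] bl)
  have "Ck_open k ?Z (\<lambda>z. jac f (fst z))"
    by (rule Ck_open_compose[where f="jac f" and g=fst, OF open_UNIV open_UNIV _ assms])
      (auto intro: Ck_open_bounded_linear bounded_linear_fst)
  then have J: "Ck_open k ?Z (\<lambda>z. jac f (fst z) $ l)" for l
    by (rule comp[OF bounded_linear_vec_nth])
  have "Ck_open k ?Z (\<lambda>z. if l = i then \<Sum>l\<in>UNIV. fst (snd (snd z)) $ l *\<^sub>R fst (snd z) $ l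
      else if l = j then \<Sum>l\<in>UNIV. snd (snd (snd z)) $ l *\<^sub>R fst (snd z) $ l else fst (snd z) $ l)" for l
    using A[of l] Ck_open_sum[OF open_UNIV Ck_open_scaleR[OF open_UNIV c A]]
      Ck_open_sum[OF open_UNIV Ck_open_scaleR[OF open_UNIV d A]]
    by (cases "l = i"; cases "l = j") simp_all
  then show ?thesis
    unfolding degenerate_param_def case_prod_beta
    by (intro Ck_open_vec_lambda Ck_open_add Ck_open_scaleR Ck_open_const J open_UNIV)
qed

text \<open>Contraposition of \<open>S.simplicial\<close>: a violation of nondegeneracy provides
  \<open>x\<close>, a weight \<open>w\<close> and a nonzero zero-sum \<open>u\<close>, both
  relations between the rows of \<open>jac f x + \<pi>\<close>, and \<open>two_relations\<close>
  solves them for two rows.\<close>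

lemma not_simplicial_degenerate:
  fixes f :: "real ^ 'm \<Rightarrow> real ^ 'l"
  assumes card: "CARD('l) \<le> CARD('m)" and r: "2 \<le> r" and smooth: "Cp_open r UNIV f"
    and conv: "strongly_convex_mapping UNIV f"
    and not: "\<not> simplicial_problem (r - 1) UNIV (\<lambda>x. f x + \<pi> *v x)"
  obtains i j where "i \<noteq> j"
    "\<pi> \<in> degenerate_param f i j ` {z. \<forall>b\<in>Basis - degenerate_directions i j. z \<bullet> b = 0}"
proof -
  let ?g = "\<lambda>x. f x + \<pi> *v x"
  have diff: "h differentiable (at x)" if "Cp_open r UNIV h" for h :: "real ^ 'm \<Rightarrow> real ^ 'l" and x
  proof -
    have "enat (Suc 0) \<le> r"
      using r by (cases r) (auto simp: numeral_eq_enat)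
    then have "Ck_open (Suc 0) UNIV h" using that unfolding Cp_open_def by blast
    then show ?thesis by simp
  qed
  note smooth_g = Cp_open_add_linear[OF smooth, of \<pi>]
  obtain \<alpha> where \<alpha>: "\<alpha> > 0"
    "\<And>x y i. ?g x $ i + jac ?g x $ i \<bullet> (y - x) + \<alpha> / 2 * (norm (y - x))\<^sup>2 \<le> ?g y $ i"
    using strongly_convex_mapping_gradient_ineq[OF strongly_convex_mapping_add_linear[OF conv] diff[OF smooth_g]]
    by blast
  have r1: "1 \<le> r - 1" "r - 1 \<le> r"
    using r by (cases r; auto simp: one_enat_def numeral_eq_enat)+
  interpret S: smooth_strongly_convex ?g "r - 1" \<alpha>
    by unfold_locales (use r1 \<alpha> Cp_open_mono[OF smooth_g] Cp_open_jac[OF smooth_g r] in blast)+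
  obtain x w u where w: "w \<in> simplex_face UNIV" "wgrad ?g w x = 0"
    and u: "wgrad ?g u x = 0" "(\<Sum>i\<in>UNIV. u $ i) = 0" "u \<noteq> 0"
    using S.simplicial[OF _ card] not by blast
  let ?B = "($) (jac f x + \<pi>)"
  have B: "wgrad ?g v x = (\<Sum>k\<in>UNIV. v $ k *\<^sub>R ?B k)" for v
    by (simp only: wgrad_def jac_add_linear[OF diff[OF smooth]])
  have "($) u \<noteq> (\<lambda>_. 0)" using u(3) by (auto simp: vec_eq_iff fun_eq_iff)
  moreover have "(\<Sum>k\<in>UNIV. w $ k) = 1" using w(1) by (simp add: simplex_face_def)
  ultimately obtain i j c d where ij: "i \<noteq> j" "\<And>k. k \<in> {i, j} \<Longrightarrow> c k = 0 \<and> d k = 0"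
    "(\<Sum>k\<in>UNIV. c k *\<^sub>R (if k \<in> {i, j} then 0 else ?B k)) = ?B i"
    "(\<Sum>k\<in>UNIV. d k *\<^sub>R (if k \<in> {i, j} then 0 else ?B k)) = ?B j"
    using two_relations[OF w(2)[unfolded B] _ u(1)[unfolded B] u(2)] by blast
  let ?z = "(x, \<chi> k. if k \<in> {i, j} then 0 else ?B k, \<chi> k. c k, \<chi> k. d k)"
  have "\<pi> = degenerate_param f i j ?z"
    unfolding degenerate_param_def case_prod_conv vec_lambda_beta ij(3,4)
    by (auto simp: vec_eq_iff)
  moreover have "\<forall>b\<in>Basis - degenerate_directions i j. ?z \<bullet> b = 0"
    using ij(2) by (intro degenerate_directions_orthogonal) auto
  ultimately show thesis using that[OF ij(1)] by blast
qed

theorem theorem6p4: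
  fixes f :: "real ^ 'm \<Rightarrow> real ^ 'l" and r :: enat and s :: real
  assumes "CARD('l) \<le> CARD('m)"
    and "2 \<le> r"
    and "Cp_open r UNIV f"
    and "strongly_convex_mapping UNIV f"
    and "int CARD('m) - 2 * int CARD('l) + 4 > 0"
    and "0 \<le> s"
    and "s > real CARD('m) * real CARD('l) - (real CARD('m) - 2 * real CARD('l) + 4)"
  shows "hausdorff_outer_measure s
           {\<pi> :: real ^ 'm ^ 'l. \<not> simplicial_problem (r - 1) UNIV (\<lambda>x. f x + \<pi> *v x)} = 0"
proof -
  let ?S = "{\<pi> :: real ^ 'm ^ 'l. \<not> simplicial_problem (r - 1) UNIV (\<lambda>x. f x + \<pi> *v x)}"
  let ?P = "{(i, j). i \<noteq> (j :: 'l)}"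
  let ?T = "\<lambda>(i, j). degenerate_param f i j ` {z. \<forall>b\<in>Basis - degenerate_directions i j. z \<bullet> b = 0}"
  have sub: "?S \<subseteq> (\<Union>q\<in>?P. ?T q)"
  proof
    fix \<pi> assume "\<pi> \<in> ?S"
    then have "\<not> simplicial_problem (r - 1) UNIV (\<lambda>x. f x + \<pi> *v x)" by simp
    then show "\<pi> \<in> (\<Union>q\<in>?P. ?T q)"
    proof (rule not_simplicial_degenerate[OF assms(1-4)])
      fix i j :: 'l
      assume "i \<noteq> j" "\<pi> \<in> degenerate_param f i j ` {z. \<forall>b\<in>Basis - degenerate_directions i j. z \<bullet> b = 0}"
      then show "\<pi> \<in> (\<Union>q\<in>?P. ?T q)"
        by (intro UN_I[of "(i, j)"]) simp_all
    qed
  qed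
  show ?thesis
  proof (cases "CARD('l) \<ge> 2")
    case True
    \<comment> \<open>Writing \<open>l = n + 2\<close> removes the truncated subtraction:
      \<open>m + n * m + 2 * n\<close> equals \<open>m * l - (m - 2 * l + 4)\<close>, the bound on
      \<open>s\<close>.\<close>
    then obtain n where n: "CARD('l) = n + 2" by (metis add.commute le_Suc_ex)
    have dim: "real (CARD('m) + (CARD('l) - 2) * CARD('m) + 2 * (CARD('l) - 2)) < s"
      using assms(7) unfolding n by (simp add: algebra_simps)
    then have s: "s > 0" by (smt (verit) of_nat_0_le_iff)
    \<comment> \<open>Here \<open>2 \<le> r\<close> is essential: the image estimate needs a
      parametrisation of class \<open>C^1\<close>.\<close>
    have "Ck_open (Suc 0) UNIV (jac f)"
      using Cp_open_jac[OF assms(3,2)] assms(2) unfolding Cp_open_def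
      by (cases r) (auto simp: one_enat_def numeral_eq_enat simp del: Ck_open.simps)
    then have null: "hausdorff_outer_measure s (?T (i, j)) = 0" if "i \<noteq> j" for i j
      unfolding case_prod_conv
      using order.strict_trans1[OF of_nat_mono[OF card_degenerate_directions[OF that, where 'm='m]] dim]
      by (intro hausdorff_null_C1_image Ck_open_degenerate_param degenerate_directions_Basis)
    have "hausdorff_outer_measure s (?T q) = 0" if "q \<in> ?P" for q
    proof (cases q)
      case (Pair i j)
      then have "i \<noteq> j" using that by simp
      from null[OF this] show ?thesis unfolding Pair .
    qed
    then have "hausdorff_outer_measure s (\<Union>q\<in>?P. ?T q) = 0"
      using s by (intro hausdorff_null_UN_finite) auto
    then show ?thesis using sub s by (rule hausdorff_null_subset)
  next
    case False
    then have "CARD('l) = 1" by (metis One_nat_def Suc_1 le_SucE not_less_eq_eq zero_less_card_finite less_one linorder_not_le)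
    then obtain k :: 'l where "UNIV = {k}" by (auto simp: card_1_singleton_iff)
    \<comment> \<open>For a single objective there is no pair of distinct rows, so the bad set is
      empty. The bound on \<open>s\<close> then admits \<open>s = 0\<close>, where the measure is
      the number of points and is treated separately.\<close>
    then have "?P = {}" by (metis (mono_tags, lifting) UNIV_I case_prodE empty_Collect_eq singletonD)
    then have "?S = {}" using sub by blast
    moreover have "hausdorff_outer_measure s ({} :: (real ^ 'm ^ 'l) set) = 0"
    proof (cases "s = 0")
      case True
      then show ?thesis by (simp add: hausdorff_outer_measure_def)
    next
      case False
      then show ?thesis
        using assms(6) hausdorff_null_UN_finite[of "{}" s "\<lambda>_. {}"] by simp
    qed
    ultimately show ?thesis by simp
  qed
qed

end
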